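(* The following algorithm, given the representation $\mathcal{R}(\mathcal{G})$ of a temporal clique $\mathcal{G}=((V,E),\lambda)$ on $n\ge 2$ nodes, runs in time linear in the input size ($O(n^2)$), returns True if and only if $\mathcal{G}$ is a 1D-mobility temporal clique, and in that case the ordering $\pi$ it computes is an initial ordering from which $\mathcal{R}(\mathcal{G})$ is a 1D-mobility schedule. Algorithm. TriangleExtremities$(\{u,v,w\})$ returns the pair forming the edge among $uv,vw,uw$ whose label is the median of the three labels. ExtremalNodes$(W)$: pick any two nodes $u,v\in W$, set $X=\{u,v\}$, and for each remaining node $w$ of $W$ (in any order) set $X:=$ TriangleExtremities$(X\cup\{w\})$; return $X$. VertexSorting: let $\{a,z\}=$ ExtremalNodes$(V)$; start $\pi=(a)$ and $U:=V\setminus\{a\}$; while $U\neq\{z\}$: let $X=$ ExtremalNodes$(U)$; if $z\notin X$ return failure; otherwise let $b$ be the node of $X\setminus\{z\}$, append $b$ to $\pi$ and remove $b$ from $U$; finally append $z$ and return $\pi$. Main procedure: compute $\pi$ by VertexSorting; on failure return False; otherwise scan the triples $(u,v,t)$ of $\mathcal{R}(\mathcal{G})$ in increasing order of $t$: if $u,v$ are consecutive in the current ordering, exchange them, else return False; after the scan return True.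
   Context: A temporal clique $\mathcal{G}=((V,E),\lambda)$ is a complete graph on $n$ nodes with each edge given a single label, labels pairwise distinct; its representation $\mathcal{R}(\mathcal{G})$ is the list of triples $(u,v,\lambda(uv))$ sorted by label. 1D-mobility model: agents lie on a line in an initial ordering $\pi$. A 1D-mobility schedule from $\pi$ is a sequence $x=(x_1,\dots,x_T)$ of pairs where, with $\pi_0=\pi$, each $x_t=\{u,v\}$ consists of two agents consecutive in $\pi_{t-1}$ and $\pi_t$ is obtained by exchanging them. $\mathcal{G}_{\pi,x}$ is the temporal graph with edge $uv$ at time $t$ whenever $x_t=uv$. A 1D-mobility temporal clique is a temporal clique isomorphic (via a label-preserving vertex bijection, labels considered up to order-preserving relabeling) to some $\mathcal{G}_{\pi,x}$. "$\mathcal{R}(\mathcal{G})$ is a 1D-mobility schedule from $\pi$" means that the sequence of edges of $\mathcal{R}(\mathcal{G})$, read in increasing label order as crossings, is a valid 1D-mobility schedule from $\pi$. *)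

theory Defs
  imports Main "HOL-Library.Monad_Syntax"
begin

section \<open>Temporal graphs and temporal cliques\<close>

text \<open>An undirected edge \<open>uv\<close> is the two-element set \<open>{u, v}\<close>; in a general temporal graph an edge
  carries a set of time labels. Values of \<open>labels\<close> outside \<open>edges\<close> are irrelevant.\<close>

record 'v temporal_graph =
  nodes :: "'v set"
  edges :: "'v set set"
  labels :: "'v set \<Rightarrow> nat set"

definition temporal_clique :: "'v temporal_graph \<Rightarrow> bool" where
  "temporal_clique G \<longleftrightarrow>
     finite (nodes G) \<and>
     edges G = {{u, v} | u v. u \<in> nodes G \<and> v \<in> nodes G \<and> u \<noteq> v} \<and>
     (\<forall>e\<in>edges G. \<exists>t. labels G e = {t}) \<and>
     (\<forall>e\<in>edges G. \<forall>e'\<in>edges G. e \<noteq> e' \<longrightarrow> labels G e \<inter> labels G e' = {})"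

type_synonym 'v triple = "'v \<times> 'v \<times> nat"

text \<open>\<open>R\<close> is the list of the triples \<open>(u, v, \<lambda>(uv))\<close>, sorted by label. Each edge occurs once, in
  either of its two orientations; strict sortedness costs nothing because labels are distinct.\<close>

definition is_representation :: "'v triple list \<Rightarrow> 'v temporal_graph \<Rightarrow> bool" where
  "is_representation R G \<longleftrightarrow>
     sorted_wrt (<) (map (\<lambda>(u, v, t). t) R) \<and>
     (\<lambda>(u, v, t). ({u, v}, t)) ` set R = {(e, t). e \<in> edges G \<and> t \<in> labels G e}"

definition edge_sequence :: "'v triple list \<Rightarrow> 'v set list" where
  "edge_sequence R = map (\<lambda>(u, v, t). {u, v}) R"

definition isomorphic :: "'a temporal_graph \<Rightarrow> 'b temporal_graph \<Rightarrow> bool" where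
  "isomorphic G H \<longleftrightarrow>
     (\<exists>f \<phi>. bij_betw f (nodes G) (nodes H) \<and>
        edges H = (\<lambda>e. f ` e) ` edges G \<and>
        strict_mono_on (\<Union>e\<in>edges G. labels G e) \<phi> \<and>
        (\<forall>e\<in>edges G. labels H (f ` e) = \<phi> ` labels G e))"

section \<open>The 1D-mobility model\<close>

text \<open>An ordering of the agents is a list without repetitions. \<open>crossing \<pi> e \<pi>'\<close>: the two agents
  forming \<open>e\<close> are consecutive in \<open>\<pi>\<close>, and exchanging them gives \<open>\<pi>'\<close>.\<close>

inductive crossing :: "'v list \<Rightarrow> 'v set \<Rightarrow> 'v list \<Rightarrow> bool" where
  "crossing (xs @ u # v # ys) {u, v} (xs @ v # u # ys)"

inductive schedule_steps :: "'v list \<Rightarrow> 'v set list \<Rightarrow> bool" where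
  "schedule_steps \<pi> []"
| "crossing \<pi> e \<pi>' \<Longrightarrow> schedule_steps \<pi>' x \<Longrightarrow> schedule_steps \<pi> (e # x)"

definition mobility_schedule :: "'v list \<Rightarrow> 'v set list \<Rightarrow> bool" where
  "mobility_schedule \<pi> x \<longleftrightarrow> distinct \<pi> \<and> schedule_steps \<pi> x"

text \<open>Times run from 1 to \<open>T = length x\<close>, whereas list positions start at 0.\<close>

definition mobility_graph :: "'v list \<Rightarrow> 'v set list \<Rightarrow> 'v temporal_graph" where
  "mobility_graph \<pi> x =
     \<lparr>nodes = set \<pi>, edges = set x,
      labels = (\<lambda>e. {t. 1 \<le> t \<and> t \<le> length x \<and> x ! (t - 1) = e})\<rparr>"

text \<open>Taking the agents from the type of the nodes loses no generality: agents of any other type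
  can be renamed along the isomorphism.\<close>

definition mobility_clique :: "'v temporal_graph \<Rightarrow> bool" where
  "mobility_clique G \<longleftrightarrow>
     temporal_clique G \<and>
     (\<exists>(\<pi> :: 'v list) x. mobility_schedule \<pi> x \<and> isomorphic G (mobility_graph \<pi> x))"

section \<open>Nondeterministic programs with running time\<close>

text \<open>The machine model is a unit-cost RAM whose words hold nodes, labels and list positions.
  A program is the set of outcomes of its runs: \<open>Done x c\<close> is a run that halts with result \<open>x\<close>
  after time \<open>c\<close>, and \<open>Wrong\<close> is a run that fails to halt or performs an illegal operation (reading
  an unset memory cell, say). Several outcomes express arbitrary choices of the algorithm. The
  time spent is additive along sequential composition.\<close>

datatype 'a outcome = Done 'a nat | Wrong

datatype 'a prog = Prog (outcomes: "'a outcome set")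

definition bind_prog :: "'a prog \<Rightarrow> ('a \<Rightarrow> 'b prog) \<Rightarrow> 'b prog" where
  "bind_prog m f = Prog
     ({Done y (c + d) | x c y d. Done x c \<in> outcomes m \<and> Done y d \<in> outcomes (f x)} \<union>
      {Wrong | x c. Done x c \<in> outcomes m \<and> Wrong \<in> outcomes (f x)} \<union>
      {r. r = Wrong \<and> Wrong \<in> outcomes m})"

adhoc_overloading Monad_Syntax.bind \<rightleftharpoons> bind_prog

definition wrong :: "'a prog" where
  "wrong = Prog {Wrong}"

text \<open>One instruction. It is used only for a bounded number of register operations: comparing
  or combining a bounded number of words, appending to an array, and inserting into, deleting
  from, or comparing with a singleton, a set of nodes. A node set is thought of as an array of its
  elements together with a table giving the position of each element in the array.\<close>

definition ret :: "'a \<Rightarrow> 'a prog" where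
  "ret x = Prog {Done x 1}"

text \<open>Tables are random-access memory addressed by a node or a pair of nodes; allocating one
  does not initialise it. Every table is used single-threadedly, so that writing is in place.\<close>

type_synonym ('k, 'a) table = "'k \<Rightarrow> 'a option"

definition new_table :: "('k, 'a) table prog" where
  "new_table = ret Map.empty"

definition read_table :: "('k, 'a) table \<Rightarrow> 'k \<Rightarrow> 'a prog" where
  "read_table m k = (case m k of None \<Rightarrow> wrong | Some x \<Rightarrow> ret x)"

definition write_table :: "('k, 'a) table \<Rightarrow> 'k \<Rightarrow> 'a \<Rightarrow> ('k, 'a) table prog" where
  "write_table m k x = ret (m(k \<mapsto> x))"

text \<open>Copy out the elements of a node set, in any order, in time linear in its size.\<close>

definition enumerate_nodes :: "'v set \<Rightarrow> 'v list prog" where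
  "enumerate_nodes W =
     (if finite W then Prog {Done xs (1 + card W) | xs. distinct xs \<and> set xs = W} else wrong)"

text \<open>Name the two elements of an unordered pair, in either of the two possible ways.\<close>

definition pair_elements :: "'v set \<Rightarrow> ('v \<times> 'v) prog" where
  "pair_elements X =
     (if card X = 2 then Prog {Done (p, q) 1 | p q. X = {p, q}} else wrong)"

primrec foreach :: "'a list \<Rightarrow> ('a \<Rightarrow> 's \<Rightarrow> 's prog) \<Rightarrow> 's \<Rightarrow> 's prog" where
  "foreach [] f s = ret s"
| "foreach (x # xs) f s = do { ret (); s' \<leftarrow> f x s; foreach xs f s' }"

text \<open>Every evaluation of the condition takes one time unit. The last rule makes an infinite
  execution of the loop an outcome \<open>Wrong\<close>.\<close>

inductive while_outcome :: "('s \<Rightarrow> bool) \<Rightarrow> ('s \<Rightarrow> 's prog) \<Rightarrow> 's \<Rightarrow> 's outcome \<Rightarrow> bool"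
  for b :: "'s \<Rightarrow> bool" and f :: "'s \<Rightarrow> 's prog" where
  stop: "\<not> b s \<Longrightarrow> while_outcome b f s (Done s 1)"
| again: "b s \<Longrightarrow> Done s' c \<in> outcomes (f s) \<Longrightarrow> while_outcome b f s' (Done s'' d) \<Longrightarrow>
     while_outcome b f s (Done s'' (1 + c + d))"
| wrong_now: "b s \<Longrightarrow> Wrong \<in> outcomes (f s) \<Longrightarrow> while_outcome b f s Wrong"
| wrong_later: "b s \<Longrightarrow> Done s' c \<in> outcomes (f s) \<Longrightarrow> while_outcome b f s' Wrong \<Longrightarrow>
     while_outcome b f s Wrong"
| diverge: "(\<And>i. b (\<sigma> i)) \<Longrightarrow> (\<And>i::nat. \<exists>c. Done (\<sigma> (Suc i)) c \<in> outcomes (f (\<sigma> i))) \<Longrightarrow>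
     while_outcome b f (\<sigma> 0) Wrong"

definition while_prog :: "('s \<Rightarrow> bool) \<Rightarrow> ('s \<Rightarrow> 's prog) \<Rightarrow> 's \<Rightarrow> 's prog" where
  "while_prog b f s = Prog {r. while_outcome b f s r}"

section \<open>The recognition algorithm\<close>

type_synonym 'v label_table = "('v \<times> 'v, nat) table"

text \<open>The node set and the table of the labels are computed from the representation.\<close>

definition load :: "'v triple list \<Rightarrow> ('v set \<times> 'v label_table) prog" where
  "load R = do {
     L0 \<leftarrow> new_table;
     V0 \<leftarrow> ret {};
     foreach R (\<lambda>(u, v, t) (V, L). do {
       L1 \<leftarrow> write_table L (u, v) t;
       L2 \<leftarrow> write_table L1 (v, u) t;
       V1 \<leftarrow> ret (insert u V);
       V2 \<leftarrow> ret (insert v V1);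
       ret (V2, L2)
     }) (V0, L0)
   }"

definition is_median :: "nat \<Rightarrow> nat \<Rightarrow> nat \<Rightarrow> bool" where
  "is_median m x y \<longleftrightarrow> x < m \<and> m < y \<or> y < m \<and> m < x"

definition triangle_extremities :: "'v label_table \<Rightarrow> 'v \<Rightarrow> 'v \<Rightarrow> 'v \<Rightarrow> 'v set prog" where
  "triangle_extremities L u v w = do {
     uv \<leftarrow> read_table L (u, v);
     vw \<leftarrow> read_table L (v, w);
     uw \<leftarrow> read_table L (u, w);
     ret (if is_median uv vw uw then {u, v}
          else if is_median vw uv uw then {v, w}
          else {u, w})
   }"

definition extremal_nodes :: "'v label_table \<Rightarrow> 'v set \<Rightarrow> 'v set prog" where
  "extremal_nodes L W = do {
     xs \<leftarrow> enumerate_nodes W;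
     (case xs of
        u # v # ws \<Rightarrow>
          foreach ws (\<lambda>w X. do {
            (p, q) \<leftarrow> pair_elements X;
            triangle_extremities L p q w
          }) {u, v}
      | _ \<Rightarrow> wrong)
   }"

text \<open>The flag in the loop state records that failure has been returned; a final result \<open>None\<close>
  is this failure.\<close>

definition vertex_sorting :: "'v label_table \<Rightarrow> 'v set \<Rightarrow> 'v list option prog" where
  "vertex_sorting L V = do {
     A \<leftarrow> extremal_nodes L V;
     (a, z) \<leftarrow> pair_elements A;
     U0 \<leftarrow> ret (V - {a});
     \<pi>0 \<leftarrow> ret [a];
     (failed, U, \<pi>) \<leftarrow> while_prog (\<lambda>(failed, U, \<pi>). \<not> failed \<and> U \<noteq> {z})
       (\<lambda>(failed, U, \<pi>). do {
          X \<leftarrow> extremal_nodes L U;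
          (p, q) \<leftarrow> pair_elements X;
          z_in_X \<leftarrow> ret (z = p \<or> z = q);
          (if \<not> z_in_X then ret (True, U, \<pi>)
           else do {
             b \<leftarrow> ret (if z = p then q else p);
             \<pi>' \<leftarrow> ret (\<pi> @ [b]);
             U' \<leftarrow> ret (U - {b});
             ret (False, U', \<pi>')
           })
        }) (False, U0, \<pi>0);
     (if failed then ret None
      else do { \<pi>' \<leftarrow> ret (\<pi> @ [z]); ret (Some \<pi>') })
   }"

text \<open>While the triples are scanned, the current ordering is stored as the table of the positions
  of the nodes.\<close>

definition positions :: "'v list \<Rightarrow> ('v, nat) table prog" where
  "positions \<pi> = do {
     P0 \<leftarrow> new_table;
     (i, P) \<leftarrow> foreach \<pi> (\<lambda>v (i, P). do { P' \<leftarrow> write_table P v i; ret (i + 1, P') }) (0, P0);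
     ret P
   }"

fun scan :: "'v triple list \<Rightarrow> ('v, nat) table \<Rightarrow> bool prog" where
  "scan [] P = ret True"
| "scan ((u, v, t) # R) P = do {
     i \<leftarrow> read_table P u;
     j \<leftarrow> read_table P v;
     consecutive \<leftarrow> ret (i = j + 1 \<or> j = i + 1);
     (if consecutive then do {
        P1 \<leftarrow> write_table P u j;
        P2 \<leftarrow> write_table P1 v i;
        scan R P2
      }
      else ret False)
   }"

text \<open>The result is the returned Boolean, together with the ordering computed by
  \<^const>\<open>vertex_sorting\<close>, if any.\<close>

definition recognize :: "'v triple list \<Rightarrow> (bool \<times> 'v list option) prog" where
  "recognize R = do {
     (V, L) \<leftarrow> load R;
     sorting \<leftarrow> vertex_sorting L V;
     (case sorting of
        None \<Rightarrow> ret (False, None)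
      | Some \<pi> \<Rightarrow> do {
          P \<leftarrow> positions \<pi>;
          answer \<leftarrow> scan R P;
          ret (answer, Some \<pi>)
        })
   }"

end

theory Submission
  imports Defs
begin

text \<open>Suppose that the representation is a schedule from \<open>\<pi>\<close>. If \<open>v\<close> lies between \<open>u\<close> and \<open>w\<close>
  in \<open>\<pi>\<close>, then exactly one of \<open>uv\<close> and \<open>vw\<close> precedes \<open>uw\<close>, so that \<open>uw\<close> carries the median
  label of the triangle. Hence the extremal nodes of a set are its first and its last node in \<open>\<pi>\<close>,
  and the sorting returns \<open>\<pi>\<close> or its reversal, from both of which the representation is a schedule.
  Conversely, a successful scan exhibits a schedule, whatever the ordering computed.\<close>

section \<open>Total correctness with time bounds\<close>

text \<open>The algorithm is run on every temporal clique, so no ordering is at hand while it sorts,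
  and its choices of nodes and of names for pairs are arbitrary. Hence \<open>guarantees\<close>
  speaks of all outcomes (and asks for one, lest a program without runs satisfy it), and each
  invariant has two layers. Unconditionally, sets and pairs have the right size and stay within the
  node set, so that every run is legal and within its time budget. Conditionally, for every key
  \<open>k\<close> compatible with the labels, the nodes found are the extremities for
  \<open>k\<close>. As the run does not depend on \<open>k\<close>, a failure shows that no
  compatible key exists, so answering False is right. A pair does not tell its first node from its
  last; since compatibility is preserved by negating \<open>k\<close>, it suffices to follow keys
  that increase from \<open>a\<close> to \<open>z\<close>. The time is quadratic because an
  iteration of the sorting is linear in the set of remaining nodes, which then loses one node. A
  clique on \<open>n >= 2\<close> nodes has at least \<open>n^2 / 4\<close> edges, so the same bound
  is linear in the representation.\<close>

definition guarantees :: "'a prog \<Rightarrow> ('a \<Rightarrow> nat \<Rightarrow> bool) \<Rightarrow> bool" where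
  "guarantees m Q \<longleftrightarrow>
     outcomes m \<noteq> {} \<and> (\<forall>r\<in>outcomes m. \<exists>x c. r = Done x c \<and> Q x c)"

lemma guarantees_nonempty: "guarantees m Q \<Longrightarrow> outcomes m \<noteq> {}"
  by (simp add: guarantees_def)

lemma guaranteesE:
  assumes "guarantees m Q" "r \<in> outcomes m"
  obtains x c where "r = Done x c" "Q x c"
  using assms unfolding guarantees_def by blast

lemma guarantees_mono:
  assumes "guarantees m P" "\<And>x c. P x c \<Longrightarrow> Q x c"
  shows "guarantees m Q"
  using assms unfolding guarantees_def by fast

lemma guarantees_ret [simp]: "guarantees (ret x) Q \<longleftrightarrow> Q x 1"
  by (simp add: guarantees_def ret_def)

lemma bind_ret_outcomes:
  "outcomes (bind_prog (ret x) f) =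
     {Done y (1 + d) | y d. Done y d \<in> outcomes (f x)} \<union> {r. r = Wrong \<and> Wrong \<in> outcomes (f x)}"
  by (auto simp: bind_prog_def ret_def)

text \<open>The time \<open>c\<close> already spent is charged to the postcondition of the
  continuation, so that costs accumulate along a program.\<close>

lemma guarantees_bind:
  assumes m: "guarantees m P"
    and f: "\<And>x c. P x c \<Longrightarrow> guarantees (f x) (\<lambda>y d. Q y (c + d))"
  shows "guarantees (bind_prog m f) Q"
proof -
  obtain x c where x: "Done x c \<in> outcomes m" "P x c"
    using m unfolding guarantees_def by fast
  obtain y d where "Done y d \<in> outcomes (f x)"
    using f[OF x(2)] unfolding guarantees_def by fast
  with x(1) have "outcomes (bind_prog m f) \<noteq> {}"
    unfolding bind_prog_def by auto
  moreover have "Wrong \<notin> outcomes m"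
    using m unfolding guarantees_def by fast
  moreover have "\<exists>y e. r = Done y e \<and> Q y (c + e)"
    if "Done x c \<in> outcomes m" "r \<in> outcomes (f x)" for x c r
  proof -
    have "P x c"
      using m that(1) unfolding guarantees_def by fast
    from f[OF this] show ?thesis
      using that(2) unfolding guarantees_def by blast
  qed
  ultimately show ?thesis
    unfolding guarantees_def bind_prog_def by fastforce
qed

text \<open>Since \<open>ret x\<close> has exactly one outcome, the composition rule can be
  inverted; as an equivalence it lets the simplifier execute straight-line code one instruction at a
  time.\<close>

lemma guarantees_bind_ret [simp]:
  "guarantees (bind_prog (ret x) f) Q \<longleftrightarrow> guarantees (f x) (\<lambda>y d. Q y (Suc d))"
proof
  assume bind: "guarantees (bind_prog (ret x) f) Q"
  then have "Wrong \<notin> outcomes (f x)" "outcomes (f x) \<noteq> {}"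
    unfolding guarantees_def bind_ret_outcomes by fast+
  moreover have "Q y (Suc d)" if "Done y d \<in> outcomes (f x)" for y d
  proof -
    have "Done y (1 + d) \<in> outcomes (bind_prog (ret x) f)"
      using that unfolding bind_ret_outcomes by blast
    then show ?thesis
      using bind unfolding guarantees_def by fastforce
  qed
  ultimately show "guarantees (f x) (\<lambda>y d. Q y (Suc d))"
    unfolding guarantees_def by (metis outcome.exhaust)
next
  assume "guarantees (f x) (\<lambda>y d. Q y (Suc d))"
  then show "guarantees (bind_prog (ret x) f) Q"
    by (intro guarantees_bind[where P = "\<lambda>y c. y = x \<and> c = 1"]) auto
qed

lemma read_table_ret [simp]: "m k = Some x \<Longrightarrow> read_table m k = ret x"
  by (simp add: read_table_def)

lemma guarantees_pair_elements:
  assumes "card X = 2" "\<And>p q. X = {p, q} \<Longrightarrow> p \<noteq> q \<Longrightarrow> Q (p, q) 1"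
  shows "guarantees (pair_elements X) Q"
proof -
  have "p \<noteq> q" if "X = {p, q}" for p q
    using that assms(1) by auto
  moreover have "\<exists>p q. X = {p, q}"
    using assms(1) by (meson card_2_iff)
  ultimately show ?thesis
    using assms by (auto simp: guarantees_def pair_elements_def)
qed

lemma guarantees_enumerate_nodes:
  assumes "finite W" "\<And>xs. distinct xs \<Longrightarrow> set xs = W \<Longrightarrow> Q xs (1 + card W)"
  shows "guarantees (enumerate_nodes W) Q"
  using assms finite_distinct_list[OF assms(1)]
  by (auto simp: guarantees_def enumerate_nodes_def)

text \<open>The invariant speaks of the prefix already traversed. Each iteration pays for its body
  and for the \<open>ret ()\<close> that starts it, hence \<open>k + 1\<close>; the leading 1 is the
  \<open>ret\<close> that ends the loop.\<close>

lemma guarantees_foreach: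
  assumes "I [] s"
    and "\<And>ps x qs s. xs = ps @ x # qs \<Longrightarrow> I ps s \<Longrightarrow>
           guarantees (f x s) (\<lambda>s' c. I (ps @ [x]) s' \<and> c \<le> k)"
  shows "guarantees (foreach xs f s) (\<lambda>s' c. I xs s' \<and> c \<le> 1 + (k + 1) * length xs)"
  using assms
proof (induction xs arbitrary: s I)
  case Nil
  then show ?case by simp
next
  case (Cons x xs)
  have "guarantees (f x s) (\<lambda>s' c. I [x] s' \<and> c \<le> k)"
    using Cons.prems(2)[of "[]"] Cons.prems(1) by simp
  moreover have "guarantees (foreach xs f s') (\<lambda>s' c. I (x # xs) s' \<and> c \<le> 1 + (k + 1) * length xs)"
    if "I [x] s'" for s'
    using Cons.IH[of "\<lambda>ps. I (x # ps)", OF that] Cons.prems(2)[of "x # _"] by simp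
  ultimately have "guarantees (bind_prog (f x s) (foreach xs f))
      (\<lambda>s' c. I (x # xs) s' \<and> c \<le> 1 + k + (k + 1) * length xs)"
    by (intro guarantees_bind[where P = "\<lambda>s' c. I [x] s' \<and> c \<le> k"])
      (auto intro: guarantees_mono[where P = "\<lambda>s' c. I (x # xs) s' \<and> c \<le> 1 + (k + 1) * length xs"])
  then have "guarantees (bind_prog (f x s) (foreach xs f))
      (\<lambda>s' c. I (x # xs) s' \<and> Suc c \<le> 1 + (k + 1) * length (x # xs))"
    by (rule guarantees_mono) simp
  then show ?case
    by simp
qed

text \<open>The time bound \<open>B\<close> also serves as the termination measure.\<close>

lemma guarantees_while:
  assumes init: "I s"
    and step: "\<And>s. I s \<Longrightarrow> b s \<Longrightarrow> guarantees (f s) (\<lambda>s' c. I s' \<and> 1 + c + B s' \<le> B s)"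
    and final: "\<And>s. I s \<Longrightarrow> \<not> b s \<Longrightarrow> 1 \<le> B s"
  shows "guarantees (while_prog b f s) (\<lambda>s' c. I s' \<and> \<not> b s' \<and> c \<le> B s)"
proof -
  have done_step: "I s' \<and> 1 + c + B s' \<le> B s"
    if "I s" "b s" "Done s' c \<in> outcomes (f s)" for s s' c
    using step[OF that(1,2)] that(3) unfolding guarantees_def by fast
  have no_wrong: "Wrong \<notin> outcomes (f s)" if "I s" "b s" for s
    using step[OF that] unfolding guarantees_def by fast
  have "\<exists>r. while_outcome b f s r"
    using init
  proof (induction "B s" arbitrary: s rule: less_induct)
    case less
    show ?case
    proof (cases "b s")
      case True
      obtain s' c where s': "Done s' c \<in> outcomes (f s)"
        using step[OF less.prems True] unfolding guarantees_def by fast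
      then have "B s' < B s" "I s'"
        using done_step[OF less.prems True s'] by auto
      then obtain r where "while_outcome b f s' r"
        using less.hyps by blast
      then show ?thesis
        using True s' by (cases r) (blast intro: while_outcome.intros)+
    next
      case False
      then show ?thesis
        by (blast intro: while_outcome.stop)
    qed
  qed
  moreover have "\<exists>s' c. r = Done s' c \<and> I s' \<and> \<not> b s' \<and> c \<le> B s"
    if "while_outcome b f s r" for r
    using that init
  proof (induction rule: while_outcome.induct)
    case (stop s)
    then show ?case using final by simp
  next
    case (again s s' c s'' d)
    then show ?case using done_step[OF again(5) again(1,2)] by fastforce
  next
    case (wrong_now s)
    then show ?case using no_wrong by blast
  next
    case (wrong_later s s' c)
    then show ?case using done_step by blast
  next
    case (diverge \<sigma>)
    have I: "I (\<sigma> i)" for i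
      using diverge done_step by (induction i) blast+
    have "B (\<sigma> (Suc i)) < B (\<sigma> i)" for i
    proof -
      obtain c where "Done (\<sigma> (Suc i)) c \<in> outcomes (f (\<sigma> i))"
        using diverge by blast
      from done_step[OF I diverge(1) this] show ?thesis by simp
    qed
    then show ?case
      using wf_iff_no_infinite_down_chain[THEN iffD1, OF wf_measure[of B]]
      by auto
  qed
  ultimately show ?thesis
    by (auto simp: guarantees_def while_prog_def)
qed

section \<open>Positions in an ordering\<close>

text \<open>An absent element gets the default \<open>length xs\<close>. A crossing does not change
  this value, which is why \<open>crossing_pos\<close> can equate whole functions.\<close>

definition pos :: "'a list \<Rightarrow> 'a \<Rightarrow> nat" where
  "pos xs x = length (takeWhile ((\<noteq>) x) xs)"

lemma pos_nth [simp]: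
  assumes "distinct xs" "i < length xs"
  shows "pos xs (xs ! i) = i"
proof -
  have "takeWhile ((\<noteq>) (xs ! i)) xs = take i xs"
    using assms by (intro takeWhile_eq_take_P_nth) (auto simp: nth_eq_iff_index_eq)
  then show ?thesis
    using assms by (simp add: pos_def)
qed

lemma map_pos: "distinct xs \<Longrightarrow> map (pos xs) xs = [0..<length xs]"
  by (rule nth_equalityI) auto

lemma inj_on_pos: "distinct xs \<Longrightarrow> inj_on (pos xs) (set xs)"
  by (rule inj_onI) (metis in_set_conv_nth pos_nth)

text \<open>The map \<open>pos xs\<close> is injective on the common elements and turns both lists
  into strictly increasing lists with the same set of values, and such a list is unique. Applied to
  orderings of agents as well as to sequences of edges.\<close>

lemma eq_if_sorted_wrt_pos:
  assumes "distinct xs" "set ys = set xs" "sorted_wrt (\<lambda>u v. pos xs u < pos xs v) ys"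
  shows "ys = xs"
proof -
  have "sorted_wrt (<) (map (pos xs) ys)"
    using assms(3) by (simp add: sorted_wrt_map)
  then show ?thesis
    using assms map_pos[OF assms(1)] inj_on_pos[OF assms(1)]
    by (intro map_sorted_distinct_set_unique[of "pos xs"]) (auto simp: strict_sorted_iff)
qed

section \<open>Crossings and schedules\<close>

lemma crossing_distinct_set:
  "crossing \<pi> e \<pi>' \<Longrightarrow> distinct \<pi>' = distinct \<pi> \<and> set \<pi>' = set \<pi>"
  by (auto elim!: crossing.cases)

text \<open>Reduces crossings to arithmetic of positions. The names \<open>a\<close> and
  \<open>b\<close> may be in either order with respect to the rule of \<open>crossing\<close>, hence
  the symmetric form of adjacency.\<close>

lemma crossing_pos:
  assumes "crossing \<pi> {a, b} \<pi>'" "distinct \<pi>"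
  shows "(pos \<pi> b = pos \<pi> a + 1 \<or> pos \<pi> a = pos \<pi> b + 1) \<and> a \<noteq> b \<and> a \<in> set \<pi> \<and> b \<in> set \<pi> \<and>
    pos \<pi>' = (pos \<pi>)(a := pos \<pi> b, b := pos \<pi> a)"
  using assms(1)
proof (cases rule: crossing.cases)
  case (1 xs u v ys)
  have *: "takeWhile ((\<noteq>) x) (xs @ zs) = xs @ takeWhile ((\<noteq>) x) zs" if "x \<notin> set xs" for x zs
    using that by (auto intro: takeWhile_append2)
  have **: "takeWhile ((\<noteq>) x) (xs @ zs) = takeWhile ((\<noteq>) x) xs" if "x \<in> set xs" for x zs
    using that by (auto intro: takeWhile_append1)
  have uv: "pos \<pi> u = length xs" "pos \<pi> v = length xs + 1" "pos \<pi>' v = length xs"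
      "pos \<pi>' u = length xs + 1" "u \<noteq> v"
    using 1 assms(2) by (auto simp: pos_def *)
  moreover have "pos \<pi>' x = pos \<pi> x" if "x \<noteq> u" "x \<noteq> v" for x
    using 1 that by (cases "x \<in> set xs") (simp_all add: pos_def * **)
  ultimately have "pos \<pi>' = (pos \<pi>)(u := pos \<pi> v, v := pos \<pi> u)"
    by (auto simp: fun_eq_iff)
  with uv 1 show ?thesis
    by (auto simp: doubleton_eq_iff fun_upd_twist)
qed

lemma crossing_if_consecutive:
  assumes "distinct \<pi>" "a \<in> set \<pi>" "b \<in> set \<pi>" "pos \<pi> b = pos \<pi> a + 1"
  shows "\<exists>\<pi>'. crossing \<pi> {a, b} \<pi>'"
proof -
  obtain i j where ij: "i < length \<pi>" "a = \<pi> ! i" "j < length \<pi>" "b = \<pi> ! j"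
    using assms by (metis in_set_conv_nth)
  with assms have "j = Suc i"
    by simp
  then have "\<pi> = take i \<pi> @ a # b # drop (Suc j) \<pi>"
    using ij by (metis Cons_nth_drop_Suc append_take_drop_id)
  then show ?thesis
    using crossing.intros[of "take i \<pi>" a b "drop (Suc j) \<pi>"] by metis
qed

text \<open>The positions after a crossing are determined by those before it, and an ordering is
  determined by its positions. So the scan has no other way to continue a schedule than the exchange
  it performs.\<close>

lemma crossing_unique:
  assumes "distinct \<pi>" "crossing \<pi> {a, b} \<pi>1" "crossing \<pi> {a, b} \<pi>2"
  shows "\<pi>1 = \<pi>2"
proof -
  have "pos \<pi>1 = pos \<pi>2"
    using assms crossing_pos by metis
  moreover have "distinct \<pi>1" "distinct \<pi>2" "set \<pi>1 = set \<pi>2"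
    using assms crossing_distinct_set by metis+
  moreover have "sorted_wrt (\<lambda>u v. pos \<pi>1 u < pos \<pi>1 v) \<pi>1" if "distinct \<pi>1" for \<pi>1 :: "'a list"
    using that by (simp add: sorted_wrt_iff_nth_less)
  ultimately show ?thesis
    by (metis eq_if_sorted_wrt_pos)
qed

lemma schedule_steps_Nil [simp]: "schedule_steps \<pi> []"
  by (rule schedule_steps.intros)

lemma schedule_steps_Cons:
  "schedule_steps \<pi> (e # x) \<longleftrightarrow> (\<exists>\<pi>'. crossing \<pi> e \<pi>' \<and> schedule_steps \<pi>' x)"
  by (auto elim: schedule_steps.cases intro: schedule_steps.intros)

lemma crossing_map:
  assumes "crossing \<pi> e \<pi>'"
  shows "crossing (map g \<pi>) (g ` e) (map g \<pi>')"
  using assms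
proof cases
  case (1 xs u v ys)
  then show ?thesis
    using crossing.intros[of "map g xs" "g u" "g v" "map g ys"] by simp
qed

lemma schedule_steps_map:
  "schedule_steps \<pi> x \<Longrightarrow> schedule_steps (map g \<pi>) (map (image g) x)"
  by (induction rule: schedule_steps.induct) (auto simp: schedule_steps_Cons intro: crossing_map)

lemma crossing_rev:
  assumes "crossing \<pi> e \<pi>'"
  shows "crossing (rev \<pi>) e (rev \<pi>')"
  using assms
proof cases
  case (1 xs u v ys)
  then show ?thesis
    using crossing.intros[of "rev ys" v u "rev xs"] by (simp add: insert_commute)
qed

text \<open>Adjacency has no direction. The sorting cannot tell the two ends of the line apart, and
  this makes either of its possible results acceptable.\<close>

lemma schedule_steps_rev:
  "schedule_steps \<pi> x \<Longrightarrow> schedule_steps (rev \<pi>) x"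
  by (induction rule: schedule_steps.induct) (auto simp: schedule_steps_Cons intro: crossing_rev)

text \<open>Each crossing flips the order of exactly one pair. As the edges of \<open>x\<close> are
  distinct, no pair is flipped twice, so membership in \<open>x\<close> decides whether the initial
  order has changed.\<close>

lemma schedule_steps_append:
  assumes "schedule_steps \<pi> (x @ y)" "distinct \<pi>" "distinct x"
  shows "\<exists>\<pi>'. schedule_steps \<pi>' y \<and> distinct \<pi>' \<and> set \<pi>' = set \<pi> \<and>
    (\<forall>c\<in>set \<pi>. \<forall>d\<in>set \<pi>. c \<noteq> d \<longrightarrow>
       (pos \<pi>' c < pos \<pi>' d \<longleftrightarrow> (pos \<pi> c < pos \<pi> d) \<noteq> ({c, d} \<in> set x)))"
  using assms
proof (induction x arbitrary: \<pi>)
  case Nil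
  then show ?case by auto
next
  case (Cons e x)
  then obtain \<pi>1 where \<pi>1: "crossing \<pi> e \<pi>1" "schedule_steps \<pi>1 (x @ y)"
    by (auto simp: schedule_steps_Cons)
  then obtain a b where e: "e = {a, b}"
    by (auto elim: crossing.cases)
  have \<pi>1_set: "distinct \<pi>1" "set \<pi>1 = set \<pi>"
    using \<pi>1(1) Cons.prems(2) crossing_distinct_set by metis+
  note ab = crossing_pos[OF \<pi>1(1)[unfolded e] Cons.prems(2)]
  \<comment> \<open>No third agent has a position between the adjacent \<open>a\<close> and
    \<open>b\<close>, nor one of these two positions, so \<open>e\<close> is the only pair whose
    order changes.\<close>
  have swap: "pos \<pi>1 c < pos \<pi>1 d \<longleftrightarrow> (pos \<pi> c < pos \<pi> d) \<noteq> ({c, d} = e)"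
    if "c \<in> set \<pi>" "d \<in> set \<pi>" "c \<noteq> d" for c d
  proof -
    have "x = y" if "x \<in> set \<pi>" "y \<in> set \<pi>" "pos \<pi> x = pos \<pi> y" for x y
      using inj_on_pos[OF Cons.prems(2)] that by (auto dest: inj_onD)
    then have "pos \<pi> c \<noteq> pos \<pi> a \<or> c = a" "pos \<pi> c \<noteq> pos \<pi> b \<or> c = b"
        "pos \<pi> d \<noteq> pos \<pi> a \<or> d = a" "pos \<pi> d \<noteq> pos \<pi> b \<or> d = b"
      using ab that by blast+
    then show ?thesis
      using ab \<open>c \<noteq> d\<close> unfolding e doubleton_eq_iff
      by (cases "c = a"; cases "c = b"; cases "d = a"; cases "d = b") auto
  qed
  obtain \<pi>' where \<pi>': "schedule_steps \<pi>' y" "distinct \<pi>'" "set \<pi>' = set \<pi>"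
    and before: "\<And>c d. c \<in> set \<pi> \<Longrightarrow> d \<in> set \<pi> \<Longrightarrow> c \<noteq> d \<Longrightarrow>
      pos \<pi>' c < pos \<pi>' d \<longleftrightarrow> (pos \<pi>1 c < pos \<pi>1 d) \<noteq> ({c, d} \<in> set x)"
    using Cons.IH[OF \<pi>1(2) \<pi>1_set(1)] Cons.prems(3) unfolding \<pi>1_set(2) by auto
  \<comment> \<open>The edge \<open>e\<close> does not recur in \<open>x\<close>, so the two flips
    never cancel.\<close>
  have "pos \<pi>' c < pos \<pi>' d \<longleftrightarrow> (pos \<pi> c < pos \<pi> d) \<noteq> ({c, d} \<in> set (e # x))"
    if "c \<in> set \<pi>" "d \<in> set \<pi>" "c \<noteq> d" for c d
    using before[OF that] swap[OF that] Cons.prems(3) by auto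
  with \<pi>' show ?case
    by blast
qed

text \<open>Just before \<open>u\<close> and \<open>w\<close> cross they are adjacent, so \<open>v\<close>, which starts between them, has
  already crossed one of them; had it crossed both, \<open>u\<close> and \<open>w\<close> would already be exchanged.\<close>

lemma crossed_exactly_one:
  assumes "schedule_steps \<pi> (x @ {u, w} # y)" "distinct \<pi>" "distinct (x @ {u, w} # y)"
    and "u \<in> set \<pi>" "v \<in> set \<pi>" "w \<in> set \<pi>" "pos \<pi> u < pos \<pi> v" "pos \<pi> v < pos \<pi> w"
  shows "({u, v} \<in> set x) \<noteq> ({v, w} \<in> set x)"
proof -
  obtain \<pi>' where \<pi>': "schedule_steps \<pi>' ({u, w} # y)" "distinct \<pi>'" 
    and before: "\<And>c d. c \<in> set \<pi> \<Longrightarrow> d \<in> set \<pi> \<Longrightarrow> c \<noteq> d \<Longrightarrow>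
      pos \<pi>' c < pos \<pi>' d \<longleftrightarrow> (pos \<pi> c < pos \<pi> d) \<noteq> ({c, d} \<in> set x)"
    using schedule_steps_append[OF assms(1,2)] assms(3) by auto
  have ne: "u \<noteq> v" "v \<noteq> w" "u \<noteq> w"
    using assms(7,8) by auto
  have uw: "pos \<pi>' u < pos \<pi>' w"
    using before[of u w] assms ne by simp
  moreover have "pos \<pi>' w = pos \<pi>' u + 1 \<or> pos \<pi>' u = pos \<pi>' w + 1"
    using \<pi>' crossing_pos by (metis schedule_steps_Cons)
  ultimately have adj: "pos \<pi>' w = pos \<pi>' u + 1"
    by simp
  \<comment> \<open>Adjacency leaves \<open>v\<close> either before \<open>u\<close> or after
    \<open>w\<close>. Comparing each pair in both directions also excludes equal positions.\<close>
  show ?thesis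
    using before[of u v] before[of v u] before[of v w] before[of w v] assms ne uw adj
    by (auto simp: insert_commute)
qed

section \<open>Extremal nodes\<close>

text \<open>Edges are labelled as by a mobility schedule that starts from the ordering by \<open>k\<close>. Keys are
  integers so that negation reverses the ordering.\<close>

definition compatible :: "('v set \<Rightarrow> nat) \<Rightarrow> 'v set \<Rightarrow> ('v \<Rightarrow> int) \<Rightarrow> bool" where
  "compatible lab V k \<longleftrightarrow> inj_on k V \<and>
     (\<forall>u\<in>V. \<forall>v\<in>V. \<forall>w\<in>V. k u < k v \<longrightarrow> k v < k w \<longrightarrow>
        is_median (lab {u, w}) (lab {u, v}) (lab {v, w}))"

definition spans :: "('v \<Rightarrow> int) \<Rightarrow> 'v set \<Rightarrow> 'v \<Rightarrow> 'v \<Rightarrow> bool" where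
  "spans k W a z \<longleftrightarrow> a \<in> W \<and> z \<in> W \<and> (\<forall>u\<in>W. k a \<le> k u \<and> k u \<le> k z)"

definition extremal :: "('v \<Rightarrow> int) \<Rightarrow> 'v set \<Rightarrow> 'v set \<Rightarrow> bool" where
  "extremal k W X \<longleftrightarrow> (\<exists>a z. X = {a, z} \<and> spans k W a z)"

definition table_of_labels :: "('v set \<Rightarrow> nat) \<Rightarrow> 'v set \<Rightarrow> 'v label_table \<Rightarrow> bool" where
  "table_of_labels lab V L \<longleftrightarrow> (\<forall>u\<in>V. \<forall>v\<in>V. u \<noteq> v \<longrightarrow> L (u, v) = Some (lab {u, v}))"

lemma compatible_uminus:
  assumes "compatible lab V k"
  shows "compatible lab V (\<lambda>v. - k v)"
proof -
  have "is_median (lab {u, w}) (lab {u, v}) (lab {v, w})"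
    if "u \<in> V" "v \<in> V" "w \<in> V" "k v < k u" "k w < k v" for u v w
  proof -
    have "is_median (lab {w, u}) (lab {w, v}) (lab {v, u})"
      using assms that unfolding compatible_def by blast
    then show ?thesis
      by (auto simp: is_median_def insert_commute)
  qed
  then show ?thesis
    using assms by (auto simp: compatible_def inj_on_def)
qed

text \<open>The pair is computed from the labels alone, so it is extremal for all compatible keys at
  once. A given key puts the three nodes in one of six orders; the median label is then opposite the
  middle node, and a median is unique. The time 4 is three reads and one return.\<close>

lemma triangle_extremities_guarantees:
  assumes L: "table_of_labels lab V L"
    and V: "u \<in> V" "v \<in> V" "w \<in> V" and ne: "u \<noteq> v" "w \<noteq> u" "w \<noteq> v"
  shows "guarantees (triangle_extremities L u v w) (\<lambda>X c. c = 4 \<and> X \<subseteq> {u, v, w} \<and> card X = 2 \<and>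
    (\<forall>k. compatible lab V k \<longrightarrow> extremal k {u, v, w} X))"
proof -
  let ?X = "if is_median (lab {u, v}) (lab {v, w}) (lab {u, w}) then {u, v}
            else if is_median (lab {v, w}) (lab {u, v}) (lab {u, w}) then {v, w} else {u, w}"
  have "extremal k {u, v, w} ?X" if k: "compatible lab V k" for k
  proof -
    have "k u \<noteq> k v" "k w \<noteq> k u" "k w \<noteq> k v"
      using k V ne unfolding compatible_def by (auto dest: inj_onD)
    then have order: "k u < k v \<and> k v < k w \<or> k u < k w \<and> k w < k v \<or> k v < k u \<and> k u < k w \<or>
        k v < k w \<and> k w < k u \<or> k w < k u \<and> k u < k v \<or> k w < k v \<and> k v < k u"
      by linarith
    have middle: "is_median (lab {x, z}) (lab {x, y}) (lab {y, z}) \<and> extremal k {x, y, z} {x, z}"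
      if "x \<in> V" "y \<in> V" "z \<in> V" "k x < k y" "k y < k z" for x y z
    proof -
      have "spans k {x, y, z} x z"
        using that by (auto simp: spans_def)
      then show ?thesis
        using k that unfolding compatible_def extremal_def by blast
    qed
    show ?thesis
      using order V middle[of u v w] middle[of u w v] middle[of v u w] middle[of v w u]
        middle[of w u v] middle[of w v u]
      by (elim disjE) (auto simp: is_median_def insert_commute)
  qed
  moreover have "L (u, v) = Some (lab {u, v})" "L (v, w) = Some (lab {v, w})"
      "L (u, w) = Some (lab {u, w})"
    using L V ne unfolding table_of_labels_def by auto
  ultimately show ?thesis
    using ne by (simp add: triangle_extremities_def)
qed

text \<open>All keys of \<open>W\<close> lie between those of \<open>p\<close> and \<open>q\<close>,
  so a new node has to be compared with these two only.\<close>

lemma extremal_insert: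
  assumes "extremal k W {p, q}" "extremal k {p, q, w} X"
  shows "extremal k (insert w W) X"
proof -
  obtain a z where az: "X = {a, z}" "spans k {p, q, w} a z"
    using assms(2) by (auto simp: extremal_def)
  obtain b y where "{p, q} = {b, y}" "spans k W b y"
    using assms(1) by (auto simp: extremal_def)
  then have "p \<in> W" "q \<in> W" "\<forall>u\<in>W. (k p \<le> k u \<and> k u \<le> k q) \<or> (k q \<le> k u \<and> k u \<le> k p)"
    by (auto simp: spans_def doubleton_eq_iff)
  then have "spans k (insert w W) a z"
    using az(2) by (auto simp: spans_def)
  with az(1) show ?thesis
    by (auto simp: extremal_def)
qed

text \<open>Enumeration costs \<open>1 + card W\<close>, and each of the \<open>card W - 2\<close>
  nodes of the loop costs six: one for the loop, one for naming the pair, four for the triangle.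
  Hence the factor 7.\<close>

lemma extremal_nodes_guarantees:
  assumes L: "table_of_labels lab V L" and W: "W \<subseteq> V" "finite W" "2 \<le> card W"
  shows "guarantees (extremal_nodes L W) (\<lambda>X c. c \<le> 7 * card W \<and> X \<subseteq> W \<and> card X = 2 \<and>
    (\<forall>k. compatible lab V k \<longrightarrow> extremal k W X))"
  unfolding extremal_nodes_def
proof (intro guarantees_bind guarantees_enumerate_nodes[OF W(2)])
  fix xs :: "'a list" and c
  assume xs: "distinct xs" "set xs = W"
  then have "2 \<le> length xs"
    using W(3) distinct_card by metis
  then obtain u v ws where uvw: "xs = u # v # ws"
    by (metis Suc_le_length_iff numeral_2_eq_2)
  \<comment> \<open>The first two conjuncts hold whatever the labels are: they keep
    \<open>pair_elements\<close> and the table reads legal on cliques that fit no ordering.\<close>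
  let ?I = "\<lambda>ps X. X \<subseteq> {u, v} \<union> set ps \<and> card X = 2 \<and>
    (\<forall>k. compatible lab V k \<longrightarrow> extremal k ({u, v} \<union> set ps) X)"
  have "guarantees (foreach ws (\<lambda>w X. do { (p, q) \<leftarrow> pair_elements X; triangle_extremities L p q w })
      {u, v}) (\<lambda>X c. ?I ws X \<and> c \<le> 1 + (5 + 1) * length ws)"
  proof (rule guarantees_foreach)
    have "extremal k {u, v} {u, v}" for k
    proof (cases "k u \<le> k v")
      case True
      then show ?thesis
        unfolding extremal_def spans_def by (intro exI[of _ u] exI[of _ v]) auto
    next
      case False
      then show ?thesis
        unfolding extremal_def spans_def by (intro exI[of _ v] exI[of _ u]) auto
    qed
    then show "?I [] {u, v}"
      using xs uvw by auto
  next
    fix ps w qs X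
    assume ws: "ws = ps @ w # qs" and I: "?I ps X"
    have "guarantees (triangle_extremities L p q w) (\<lambda>X' c. ?I (ps @ [w]) X' \<and> 1 + c \<le> 5)"
      if X: "X = {p, q}" "p \<noteq> q" for p q
    proof (rule guarantees_mono[OF triangle_extremities_guarantees[OF L]])
      show "p \<in> V" "q \<in> V" "w \<in> V" "p \<noteq> q" "w \<noteq> p" "w \<noteq> q"
        using X I xs uvw ws W(1) by auto
      fix X' and c :: nat
      assume X': "c = 4 \<and> X' \<subseteq> {p, q, w} \<and> card X' = 2 \<and>
        (\<forall>k. compatible lab V k \<longrightarrow> extremal k {p, q, w} X')"
      have "extremal k (insert w ({u, v} \<union> set ps)) X'" if "compatible lab V k" for k
        using I X' that unfolding X(1) by (blast intro: extremal_insert)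
      then show "?I (ps @ [w]) X' \<and> 1 + c \<le> 5"
        using X' I X(1) by (auto simp: insert_commute)
    qed
    moreover have "card X = 2"
      using I by blast
    ultimately show "guarantees (do { (p, q) \<leftarrow> pair_elements X; triangle_extremities L p q w })
        (\<lambda>X' c. ?I (ps @ [w]) X' \<and> c \<le> 5)"
      by (intro guarantees_bind[where P = "\<lambda>(p, q) c. c = 1 \<and> X = {p, q} \<and> p \<noteq> q"]
          guarantees_pair_elements) auto
  qed
  moreover have "card W = 2 + length ws" "W = {u, v} \<union> set ws"
    using xs uvw distinct_card[of xs] by auto
  ultimately show "guarantees (case xs of
        u # v # ws \<Rightarrow> foreach ws (\<lambda>w X. do { (p, q) \<leftarrow> pair_elements X; triangle_extremities L p q w })
          {u, v}
      | _ \<Rightarrow> wrong)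
    (\<lambda>X d. 1 + card W + d \<le> 7 * card W \<and> X \<subseteq> W \<and> card X = 2 \<and>
      (\<forall>k. compatible lab V k \<longrightarrow> extremal k W X))"
    unfolding uvw by (auto elim!: guarantees_mono)
qed

section \<open>Vertex sorting\<close>

text \<open>The last node of \<open>V\<close> is the last node of every subset containing it, and
  injectivity of the key makes it the only one. So an extremal pair without \<open>z\<close> rules
  out every compatible key running from \<open>a\<close> to \<open>z\<close>.\<close>

lemma spans_remove_first:
  assumes "spans k V a z" "compatible lab V k" "U \<subseteq> V" "z \<in> U" "extremal k U X"
  shows "z \<in> X \<and> (\<forall>b. X = {b, z} \<longrightarrow> b \<noteq> z \<longrightarrow> (\<forall>u\<in>U - {b}. k b < k u))"
proof -
  have inj: "x = y" if "x \<in> V" "y \<in> V" "k x = k y" for x y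
    using assms(2) that by (auto simp: compatible_def dest: inj_onD)
  obtain b y where bz: "X = {b, y}" "spans k U b y"
    using assms(5) by (auto simp: extremal_def)
  then have "k y = k z"
    using assms(1,3,4) unfolding spans_def by (meson order_antisym subsetD)
  then have "y = z"
    using inj[of y z] assms(1,3,4) bz(2) by (auto simp: spans_def)
  moreover have "k b < k u" if "u \<in> U - {b}" for u
    using bz(2) that inj[of b u] assms(3) by (force simp: spans_def)
  ultimately show ?thesis
    using bz(1) by (auto simp: doubleton_eq_iff)
qed

lemma vertex_sorting_guarantees:
  assumes L: "table_of_labels lab V L" and V: "finite V" "2 \<le> card V"
  shows "guarantees (vertex_sorting L V) (\<lambda>r c. c \<le> 30 * (card V)\<^sup>2 \<and>
    (\<forall>\<pi>. r = Some \<pi> \<longrightarrow> distinct \<pi> \<and> set \<pi> = V) \<and>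
    (\<forall>k. compatible lab V k \<longrightarrow> (\<exists>\<pi>. r = Some \<pi> \<and>
       (sorted_wrt (\<lambda>u v. k u < k v) \<pi> \<or> sorted_wrt (\<lambda>u v. k v < k u) \<pi>))))"
    (is "guarantees _ ?Q")
proof -
  let ?b = "\<lambda>z (failed, U, \<pi>). \<not> failed \<and> U \<noteq> {z}"
  let ?f = "\<lambda>z (failed, U, \<pi>). do {
          X \<leftarrow> extremal_nodes L U;
          (p, q) \<leftarrow> pair_elements X;
          z_in_X \<leftarrow> ret (z = p \<or> z = q);
          (if \<not> z_in_X then ret (True, U, \<pi>)
           else do {
             b \<leftarrow> ret (if z = p then q else p);
             \<pi>' \<leftarrow> ret (\<pi> @ [b]);
             U' \<leftarrow> ret (U - {b});
             ret (False, U', \<pi>')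
           })
        }"
  \<comment> \<open>Only keys running from \<open>a\<close> to \<open>z\<close> are followed; a key
    with the other orientation enters through its negation. That \<open>failed\<close> is false
    belongs to the conditional part, since on other cliques failure is legitimate.\<close>
  let ?I = "\<lambda>a z (failed, U, \<pi>). distinct \<pi> \<and> set \<pi> \<inter> U = {} \<and> set \<pi> \<union> U = V \<and> z \<in> U \<and>
    (\<forall>k. compatible lab V k \<longrightarrow> spans k V a z \<longrightarrow>
       \<not> failed \<and> sorted_wrt (\<lambda>u v. k u < k v) \<pi> \<and> (\<forall>u\<in>set \<pi>. \<forall>v\<in>U. k u < k v))"
  \<comment> \<open>An iteration costs about \<open>7 * card U\<close> and removes one node from
    \<open>U\<close>; the drop \<open>14 * (2 * card U - 1)\<close> of the quadratic term pays for
    it. The 1 pays for the final test of the condition, also after a failure.\<close>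
  let ?B = "\<lambda>(failed, U, \<pi>). if failed then 1 else 1 + 14 * (card U)\<^sup>2"
  have loop: "guarantees (while_prog (?b z) (?f z) (False, V - {a}, [a]))
      (\<lambda>s c. ?I a z s \<and> \<not> ?b z s \<and> c \<le> 1 + 14 * (card V)\<^sup>2)"
    if az: "a \<in> V" "z \<in> V" "a \<noteq> z" for a z
  proof -
    have "guarantees (while_prog (?b z) (?f z) (False, V - {a}, [a]))
      (\<lambda>s c. ?I a z s \<and> \<not> ?b z s \<and> c \<le> ?B (False, V - {a}, [a]))"
    proof (rule guarantees_while)
      have "k a < k u" if "compatible lab V k" "spans k V a z" "u \<in> V" "u \<noteq> a" for k u
        using that unfolding compatible_def spans_def
        by (metis inj_onD order_less_le)
      then show "?I a z (False, V - {a}, [a])"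
        using az by auto
    next
      fix s :: "bool \<times> 'a set \<times> 'a list"
      assume "\<not> ?b z s"
      then show "1 \<le> ?B s"
        by (auto split: prod.splits)
    next
      fix s
      assume Is: "?I a z s" and bs: "?b z s"
      obtain failed U \<pi> where s: "s = (failed, U, \<pi>)"
        by (cases s)
      have nf: "\<not> failed" "U \<noteq> {z}"
        using bs s by auto
      have \<pi>: "distinct \<pi>" "set \<pi> \<inter> U = {}" "set \<pi> \<union> U = V" "z \<in> U"
        and sorted: "\<And>k. compatible lab V k \<Longrightarrow> spans k V a z \<Longrightarrow>
          sorted_wrt (\<lambda>u v. k u < k v) \<pi> \<and> (\<forall>u\<in>set \<pi>. \<forall>v\<in>U. k u < k v)"
        using Is s by auto
      have U: "finite U" "U \<subseteq> V"
        using \<pi>(3) V(1) by (auto intro: finite_subset)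
      have "{z} \<subset> U"
        using \<pi>(4) nf(2) by blast
      then have card: "2 \<le> card U"
        using psubset_card_mono[OF U(1), of "{z}"] by simp
      \<comment> \<open>The summand 7 is the test of the condition, the naming of the pair and five
        \<open>ret\<close> instructions.\<close>
      have square: "7 * m + 7 + 14 * (m - 1)\<^sup>2 \<le> 14 * m\<^sup>2" if m: "2 \<le> m" for m :: nat
      proof -
        obtain l where "m = Suc (Suc l)"
          using m by (metis Suc_le_D numeral_2_eq_2 Suc_le_mono)
        then show ?thesis
          by (simp add: power2_eq_square algebra_simps)
      qed
      have "guarantees (do {
          z_in_X \<leftarrow> ret (z = p \<or> z = q);
          (if \<not> z_in_X then ret (True, U, \<pi>)
           else do {
             b \<leftarrow> ret (if z = p then q else p);
             \<pi>' \<leftarrow> ret (\<pi> @ [b]);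
             U' \<leftarrow> ret (U - {b});
             ret (False, U', \<pi>')
           })
        }) (\<lambda>s' c. ?I a z s' \<and> 1 + (d + (1 + c)) + ?B s' \<le> ?B s)"
        if X: "X \<subseteq> U" "\<And>k. compatible lab V k \<Longrightarrow> extremal k U X" "X = {p, q}" "p \<noteq> q"
          and d: "d \<le> 7 * card U" for X p q d
      proof (cases "z = p \<or> z = q")
        case True
        define b where "b = (if z = p then q else p)"
        have b: "X = {b, z}" "b \<noteq> z" "b \<in> U"
          using True X by (auto simp: b_def)
        have "sorted_wrt (\<lambda>u v. k u < k v) (\<pi> @ [b]) \<and>
            (\<forall>u\<in>set (\<pi> @ [b]). \<forall>v\<in>U - {b}. k u < k v)"
          if "compatible lab V k" "spans k V a z" for k
          using spans_remove_first[OF that(2,1) U(2) \<pi>(4) X(2)[OF that(1)]] sorted[OF that] b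
          by (auto simp: sorted_wrt_append)
        then have "?I a z (False, U - {b}, \<pi> @ [b])"
          using \<pi> b by auto
        moreover have "card (U - {b}) = card U - 1"
          using b(3) U(1) by simp
        ultimately show ?thesis
          using True d square[OF card] nf s by (simp add: b_def[symmetric])
      next
        case False
        \<comment> \<open>Missing \<open>z\<close> excludes every key in question, so the
          conditional part of the invariant becomes vacuous and the flag may be set.\<close>
        then have "\<not> (compatible lab V k \<and> spans k V a z)" for k
          using spans_remove_first[of k V a z lab U X] X U \<pi>(4) by blast
        then have "?I a z (True, U, \<pi>)"
          using \<pi> by auto
        then show ?thesis
          using False d square[OF card] nf s by simp
      qed
      then have rest: "guarantees (do {
          (p, q) \<leftarrow> pair_elements X;
          z_in_X \<leftarrow> ret (z = p \<or> z = q);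
          (if \<not> z_in_X then ret (True, U, \<pi>)
           else do {
             b \<leftarrow> ret (if z = p then q else p);
             \<pi>' \<leftarrow> ret (\<pi> @ [b]);
             U' \<leftarrow> ret (U - {b});
             ret (False, U', \<pi>')
           })
        }) (\<lambda>s' c. ?I a z s' \<and> 1 + (d + c) + ?B s' \<le> ?B s)"
        if "d \<le> 7 * card U \<and> X \<subseteq> U \<and> card X = 2 \<and>
          (\<forall>k. compatible lab V k \<longrightarrow> extremal k U X)" for X d
        using that
        by (intro guarantees_bind[where P = "\<lambda>(p, q) c. c = 1 \<and> X = {p, q} \<and> p \<noteq> q"]
            guarantees_pair_elements) (auto simp del: guarantees_bind_ret)
      show "guarantees (?f z s) (\<lambda>s' c. ?I a z s' \<and> 1 + c + ?B s' \<le> ?B s)"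
        unfolding s prod.case
        by (rule guarantees_bind[OF extremal_nodes_guarantees[OF L U(2,1) card]]) (rule rest[unfolded s prod.case])
    qed
    moreover have "(card (V - {a}))\<^sup>2 \<le> (card V)\<^sup>2"
      using V(1) by (intro power_mono card_mono) auto
    then have "?B (False, V - {a}, [a]) \<le> 1 + 14 * (card V)\<^sup>2"
      by simp
    ultimately show ?thesis
      by (elim guarantees_mono) (use order_trans in blast)
  qed
  have after: "guarantees (do {
      U0 \<leftarrow> ret (V - {a});
      \<pi>0 \<leftarrow> ret [a];
      (failed, U, \<pi>) \<leftarrow> while_prog (?b z) (?f z) (False, U0, \<pi>0);
      (if failed then ret None
       else do { \<pi>' \<leftarrow> ret (\<pi> @ [z]); ret (Some \<pi>') })
    }) (\<lambda>r c. ?Q r (d + (1 + c)))"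
    if A: "A \<subseteq> V" "\<And>k. compatible lab V k \<Longrightarrow> extremal k V A" "A = {a, z}" "a \<noteq> z"
      and d: "d \<le> 7 * card V" for A a z d
  proof -
    have az: "a \<in> V" "z \<in> V"
      using A by auto
    \<comment> \<open>With \<open>n = card V\<close> the total is at most
      \<open>14 * n^2 + 7 * n + 6\<close>; 30 is a generous round factor.\<close>
    have time: "d + (1 + (2 + (c + 2))) \<le> 30 * (card V)\<^sup>2" if "c \<le> 1 + 14 * (card V)\<^sup>2" for c
    proof -
      have "2 * card V \<le> (card V)\<^sup>2"
        using V(2) by (simp add: power2_eq_square)
      then show ?thesis
        using d that V(2) by linarith
    qed
    \<comment> \<open>The names \<open>a\<close> and \<open>z\<close> of the unordered pair were
      assigned arbitrarily, so \<open>a\<close> may be the greatest node for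
      \<open>k\<close>.\<close>
    have spans: "spans k V a z \<or> spans (\<lambda>v. - k v) V a z" if "compatible lab V k" for k
      using A(2)[OF that] A(3) by (auto simp: extremal_def spans_def doubleton_eq_iff)
    have rest: "guarantees (if failed then ret None
         else do { \<pi>' \<leftarrow> ret (\<pi> @ [z]); ret (Some \<pi>') })
        (\<lambda>r e. ?Q r (d + (1 + (2 + (c + e)))))"
      if s: "?I a z (failed, U, \<pi>)" "\<not> ?b z (failed, U, \<pi>)" "c \<le> 1 + 14 * (card V)\<^sup>2"
      for failed U \<pi> c
    proof (cases failed)
      case True
      have "\<not> compatible lab V k" for k
        using s(1) True spans[of k] compatible_uminus[of lab V k] by auto
      then show ?thesis
        using True time[OF s(3)] by simp
    next
      case False
      then have "U = {z}"
        using s(2) by simp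
      then have \<pi>: "distinct (\<pi> @ [z])" "set (\<pi> @ [z]) = V"
        using s(1) by auto
      have sorted: "sorted_wrt (\<lambda>u v. k u < k v) (\<pi> @ [z])"
        if "compatible lab V k" "spans k V a z" for k
        using s(1) that \<open>U = {z}\<close> by (auto simp: sorted_wrt_append)
      have "sorted_wrt (\<lambda>u v. k u < k v) (\<pi> @ [z]) \<or> sorted_wrt (\<lambda>u v. k v < k u) (\<pi> @ [z])"
        if "compatible lab V k" for k
        using spans[OF that] sorted[OF that] sorted[OF compatible_uminus[OF that]] by auto
      then show ?thesis
        using False \<pi> time[OF s(3)] by simp
    qed
    have "guarantees (do {
        (failed, U, \<pi>) \<leftarrow> while_prog (?b z) (?f z) (False, V - {a}, [a]);
        (if failed then ret None
         else do { \<pi>' \<leftarrow> ret (\<pi> @ [z]); ret (Some \<pi>') })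
      }) (\<lambda>r c. ?Q r (d + (1 + (2 + c))))"
    proof (rule guarantees_bind[OF loop[OF az A(4)]])
      fix s c
      assume s: "?I a z s \<and> \<not> ?b z s \<and> c \<le> 1 + 14 * (card V)\<^sup>2"
      obtain failed U \<pi> where eq: "s = (failed, U, \<pi>)"
        by (cases s)
      show "guarantees (case s of (failed, U, \<pi>) \<Rightarrow>
          if failed then ret None else do { \<pi>' \<leftarrow> ret (\<pi> @ [z]); ret (Some \<pi>') })
        (\<lambda>r e. ?Q r (d + (1 + (2 + (c + e)))))"
        unfolding eq prod.case by (rule rest) (use s eq in blast)+
    qed
    then show ?thesis
      by simp
  qed
  have "guarantees (do {
      (a, z) \<leftarrow> pair_elements A;
      U0 \<leftarrow> ret (V - {a});
      \<pi>0 \<leftarrow> ret [a];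
      (failed, U, \<pi>) \<leftarrow> while_prog (?b z) (?f z) (False, U0, \<pi>0);
      (if failed then ret None
       else do { \<pi>' \<leftarrow> ret (\<pi> @ [z]); ret (Some \<pi>') })
    }) (\<lambda>r c. ?Q r (d + c))"
    if A: "d \<le> 7 * card V \<and> A \<subseteq> V \<and> card A = 2 \<and>
          (\<forall>k. compatible lab V k \<longrightarrow> extremal k V A)" for A d
  proof (rule guarantees_bind[where P = "\<lambda>(a, z) c. c = 1 \<and> A = {a, z} \<and> a \<noteq> z"])
    show "guarantees (pair_elements A) (\<lambda>(a, z) c. c = 1 \<and> A = {a, z} \<and> a \<noteq> z)"
      using A by (intro guarantees_pair_elements) auto
  next
    fix x and c :: nat
    assume "(\<lambda>(a, z) c. c = 1 \<and> A = {a, z} \<and> a \<noteq> z) x c"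
    then obtain a z where x: "x = (a, z)" "c = 1" "A = {a, z}" "a \<noteq> z"
      by (cases x) auto
    show "guarantees (case x of (a, z) \<Rightarrow> do {
        U0 \<leftarrow> ret (V - {a});
        \<pi>0 \<leftarrow> ret [a];
        (failed, U, \<pi>) \<leftarrow> while_prog (?b z) (?f z) (False, U0, \<pi>0);
        (if failed then ret None
         else do { \<pi>' \<leftarrow> ret (\<pi> @ [z]); ret (Some \<pi>') })
      }) (\<lambda>r e. ?Q r (d + (c + e)))"
      unfolding x(1,2) prod.case by (rule after[of A]) (use A x in auto)
  qed
  then show ?thesis
    unfolding vertex_sorting_def
    by (rule guarantees_bind[OF extremal_nodes_guarantees[OF L order_refl V]])
qed


section \<open>The scan\<close>

lemma positions_guarantees:
  assumes "distinct \<pi>"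
  shows "guarantees (positions \<pi>) (\<lambda>P c. c \<le> 3 + 3 * length \<pi> \<and> (\<forall>v\<in>set \<pi>. P v = Some (pos \<pi> v)))"
proof -
  let ?I = "\<lambda>ps (i, P). i = length ps \<and> (\<forall>j<length ps. P (ps ! j) = Some j)"
  have "guarantees (foreach \<pi> (\<lambda>v (i, P). do { P' \<leftarrow> write_table P v i; ret (i + 1, P') })
      (0, Map.empty)) (\<lambda>s c. ?I \<pi> s \<and> c \<le> 1 + (2 + 1) * length \<pi>)"
  proof (rule guarantees_foreach)
    fix ps x qs and s :: "nat \<times> ('a \<Rightarrow> nat option)"
    assume \<pi>: "\<pi> = ps @ x # qs" and I: "?I ps s"
    have "ps ! j \<noteq> x" if "j < length ps" for j
      using that assms \<pi> by (auto simp: in_set_conv_nth)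
    then show "guarantees (case s of (i, P) \<Rightarrow> do { P' \<leftarrow> write_table P x i; ret (i + 1, P') })
        (\<lambda>s' c. ?I (ps @ [x]) s' \<and> c \<le> 2)"
      using I by (auto simp: write_table_def nth_append less_Suc_eq split: prod.splits)
  qed simp
  then have "guarantees (do {
      (i, P) \<leftarrow> foreach \<pi> (\<lambda>v (i, P). do { P' \<leftarrow> write_table P v i; ret (i + 1, P') }) (0, Map.empty);
      ret P
    }) (\<lambda>P c. Suc c \<le> 3 + 3 * length \<pi> \<and> (\<forall>v\<in>set \<pi>. P v = Some (pos \<pi> v)))"
    by (rule guarantees_bind) (use assms in \<open>auto simp: in_set_conv_nth\<close>)
  then show ?thesis
    by (simp add: positions_def new_table_def)
qed

lemma edge_sequence_simps [simp]:
  "edge_sequence [] = []"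
  "edge_sequence ((u, v, t) # R) = {u, v} # edge_sequence R"
  "edge_sequence (R @ S) = edge_sequence R @ edge_sequence S"
  "length (edge_sequence R) = length R"
  by (simp_all add: edge_sequence_def)

text \<open>The table holds the positions of a current ordering that is itself never stored;
  exchanging two entries is the effect of a crossing by \<open>crossing_pos\<close>. A successful
  step takes five units: two reads, one test, two writes.\<close>

lemma scan_guarantees:
  assumes "distinct \<pi>" "\<forall>(u, v, t)\<in>set R. u \<in> set \<pi> \<and> v \<in> set \<pi>"
    and "\<forall>v\<in>set \<pi>. P v = Some (pos \<pi> v)"
  shows "guarantees (scan R P) (\<lambda>answer c. c \<le> 1 + 5 * length R \<and>
    (answer \<longleftrightarrow> schedule_steps \<pi> (edge_sequence R)))"
  using assms
proof (induction R arbitrary: \<pi> P)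
  case Nil
  then show ?case by simp
next
  case (Cons x R)
  obtain u v t where x: "x = (u, v, t)"
    by (cases x)
  have uv: "u \<in> set \<pi>" "v \<in> set \<pi>"
    using Cons.prems(2) x by auto
  let ?consecutive = "pos \<pi> u = pos \<pi> v + 1 \<or> pos \<pi> v = pos \<pi> u + 1"
  show ?case
  proof (cases ?consecutive)
    case True
    then obtain \<pi>' where \<pi>': "crossing \<pi> {u, v} \<pi>'"
      using crossing_if_consecutive[OF Cons.prems(1)] uv by (metis insert_commute)
    have steps: "schedule_steps \<pi> (edge_sequence (x # R)) \<longleftrightarrow> schedule_steps \<pi>' (edge_sequence R)"
      unfolding x edge_sequence_simps schedule_steps_Cons
      using crossing_unique[OF Cons.prems(1) \<pi>'] \<pi>' by blast
    have \<pi>'_set: "distinct \<pi>'" "set \<pi>' = set \<pi>"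
      using crossing_distinct_set[OF \<pi>'] Cons.prems(1) by auto
    have "\<forall>w\<in>set \<pi>'. (P(u \<mapsto> pos \<pi> v, v \<mapsto> pos \<pi> u)) w = Some (pos \<pi>' w)"
      using Cons.prems(3) crossing_pos[OF \<pi>' Cons.prems(1)] \<pi>'_set(2) by simp
    with Cons.IH[OF \<pi>'_set(1)] Cons.prems(2) \<pi>'_set(2)
    have "guarantees (scan R (P(u \<mapsto> pos \<pi> v, v \<mapsto> pos \<pi> u))) (\<lambda>answer c. c \<le> 1 + 5 * length R \<and>
        (answer \<longleftrightarrow> schedule_steps \<pi>' (edge_sequence R)))"
      by simp
    then have "guarantees (scan R (P(u \<mapsto> pos \<pi> v, v \<mapsto> pos \<pi> u)))
        (\<lambda>answer c. 5 + c \<le> 1 + 5 * length (x # R) \<and>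
          (answer \<longleftrightarrow> schedule_steps \<pi> (edge_sequence (x # R))))"
      unfolding steps by (rule guarantees_mono) simp
    then show ?thesis
      using True Cons.prems(3) uv by (simp add: x write_table_def)
  next
    case False
    then have "\<not> schedule_steps \<pi> (edge_sequence (x # R))"
      using crossing_pos[OF _ Cons.prems(1)] x by (auto simp: schedule_steps_Cons)
    then show ?thesis
      using False Cons.prems(3) uv by (simp add: x)
  qed
qed

section \<open>Representations\<close>

text \<open>The label in a triple depends only on its unordered edge, so a cell is only ever
  overwritten by the value it already holds. Both orientations are written, so a later lookup may
  name the edge either way.\<close>

lemma load_guarantees:
  assumes "\<forall>(u, v, t)\<in>set R. t = lab {u, v}"
  shows "guarantees (load R) (\<lambda>(V, L) c. c \<le> 3 + 6 * length R \<and>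
    V = \<Union>(set (edge_sequence R)) \<and>
    (\<forall>u v. {u, v} \<in> set (edge_sequence R) \<longrightarrow> L (u, v) = Some (lab {u, v})))"
proof -
  let ?I = "\<lambda>ps (V, L). V = \<Union>(set (edge_sequence ps)) \<and>
    (\<forall>u v. {u, v} \<in> set (edge_sequence ps) \<longrightarrow> L (u, v) = Some (lab {u, v}))"
  have "guarantees (foreach R (\<lambda>(u, v, t) (V, L). do {
       L1 \<leftarrow> write_table L (u, v) t;
       L2 \<leftarrow> write_table L1 (v, u) t;
       V1 \<leftarrow> ret (insert u V);
       V2 \<leftarrow> ret (insert v V1);
       ret (V2, L2)
     }) ({}, Map.empty)) (\<lambda>s c. ?I R s \<and> c \<le> 1 + (5 + 1) * length R)"
  proof (rule guarantees_foreach)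
    fix ps x qs and s :: "'a set \<times> 'a label_table"
    assume R: "R = ps @ x # qs" and I: "?I ps s"
    obtain u v t where x: "x = (u, v, t)"
      by (cases x)
    then have t: "t = lab {u, v}"
      using assms R by auto
    obtain V L where s: "s = (V, L)"
      by (cases s)
    have "(L((u, v) \<mapsto> t, (v, u) \<mapsto> t)) (a, b) = Some (lab {a, b})"
      if "{a, b} \<in> set (edge_sequence (ps @ [x]))" for a b
    proof (cases "{a, b} = {u, v}")
      case True
      then show ?thesis
        using t by (auto simp: doubleton_eq_iff insert_commute)
    next
      case False
      then have "(a, b) \<noteq> (u, v)" "(a, b) \<noteq> (v, u)"
        by auto
      moreover have "{a, b} \<in> set (edge_sequence ps)"
        using False that unfolding x by simp
      then have "L (a, b) = Some (lab {a, b})"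
        using I unfolding s prod.case by blast
      ultimately show ?thesis
        by (simp only: fun_upd_other not_False_eq_True)
    qed
    then show "guarantees ((case x of (u, v, t) \<Rightarrow> \<lambda>(V, L). do {
         L1 \<leftarrow> write_table L (u, v) t;
         L2 \<leftarrow> write_table L1 (v, u) t;
         V1 \<leftarrow> ret (insert u V);
         V2 \<leftarrow> ret (insert v V1);
         ret (V2, L2)
       }) s) (\<lambda>s' c. ?I (ps @ [x]) s' \<and> c \<le> 5)"
      using I by (simp add: x s write_table_def insert_commute[of v u])
  qed simp
  then have "guarantees (foreach R (\<lambda>(u, v, t) (V, L). do {
       L1 \<leftarrow> write_table L (u, v) t;
       L2 \<leftarrow> write_table L1 (v, u) t;
       V1 \<leftarrow> ret (insert u V);
       V2 \<leftarrow> ret (insert v V1);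
       ret (V2, L2)
     }) ({}, Map.empty)) (\<lambda>(V, L) c. Suc (Suc c) \<le> 3 + 6 * length R \<and>
       V = \<Union>(set (edge_sequence R)) \<and>
       (\<forall>u v. {u, v} \<in> set (edge_sequence R) \<longrightarrow> L (u, v) = Some (lab {u, v})))"
    by (rule guarantees_mono) auto
  then show ?thesis
    by (simp add: load_def new_table_def case_prod_unfold)
qed

lemma distinct_if_sorted_wrt_less:
  "sorted_wrt (\<lambda>x y. f x < (f y :: nat)) xs \<Longrightarrow> distinct (map f xs)"
  by (induction xs) auto

text \<open>Replaces the set-valued labels by a function on edges. From here on a representation is
  treated as its edge sequence, strictly increasing in \<open>lab\<close>.\<close>

lemma representation_labels:
  assumes "temporal_clique G" "is_representation R G"
  obtains lab where "\<forall>e\<in>edges G. labels G e = {lab e}" "\<forall>(u, v, t)\<in>set R. t = lab {u, v}"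
    "set (edge_sequence R) = edges G" "sorted_wrt (\<lambda>d e. lab d < lab e) (edge_sequence R)"
proof -
  obtain lab where lab: "\<forall>e\<in>edges G. labels G e = {lab e}"
    using bchoice[of "edges G" "\<lambda>e t. labels G e = {t}"] assms(1) unfolding temporal_clique_def by auto
  then have pairs: "(\<lambda>(u, v, t). ({u, v}, t)) ` set R = (\<lambda>e. (e, lab e)) ` edges G"
    using assms(2) unfolding is_representation_def by auto
  then have t: "\<forall>(u, v, t)\<in>set R. t = lab {u, v}"
    by force
  have "fst ` (\<lambda>(u, v, t). ({u, v}, t)) ` set R = edges G"
    unfolding pairs by (simp add: image_image)
  then have E: "set (edge_sequence R) = edges G"
    by (simp add: edge_sequence_def image_image case_prod_unfold)
  have "map (\<lambda>(u, v, t). t) R = map lab (edge_sequence R)"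
    using t by (auto simp: edge_sequence_def)
  then have "sorted_wrt (\<lambda>d e. lab d < lab e) (edge_sequence R)"
    using assms(2) by (simp add: is_representation_def sorted_wrt_map)
  with lab t E that show thesis
    by blast
qed

section \<open>Schedules and mobility cliques\<close>

lemma compatible_pos:
  assumes "schedule_steps \<pi> E" "distinct \<pi>" "sorted_wrt (\<lambda>d e. lab d < lab e) E"
    and "\<And>u v. u \<in> set \<pi> \<Longrightarrow> v \<in> set \<pi> \<Longrightarrow> u \<noteq> v \<Longrightarrow> {u, v} \<in> set E"
  shows "compatible lab (set \<pi>) (\<lambda>v. int (pos \<pi> v))"
proof -
  have "distinct E"
    using distinct_if_sorted_wrt_less[OF assms(3)] by (simp add: distinct_map)
  have "is_median (lab {u, w}) (lab {u, v}) (lab {v, w})"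
    if uvw: "u \<in> set \<pi>" "v \<in> set \<pi>" "w \<in> set \<pi>" "pos \<pi> u < pos \<pi> v" "pos \<pi> v < pos \<pi> w" for u v w
  proof -
    have ne: "u \<noteq> v" "v \<noteq> w" "u \<noteq> w"
      using uvw by auto
    then obtain x y where E: "E = x @ {u, w} # y"
      using assms(4)[of u w] uvw by (meson split_list)
    \<comment> \<open>Splitting the sequence at \<open>{u, w}\<close> separates smaller labels from
      larger ones, so having exactly one of \<open>{u, v}\<close> and \<open>{v, w}\<close> in
      \<open>x\<close> is the median condition.\<close>
    have order: "if e \<in> set x then lab e < lab {u, w} else lab {u, w} < lab e"
      if "e \<in> set E" "e \<noteq> {u, w}" for e
      using that assms(3) unfolding E by (auto simp: sorted_wrt_append)
    have "({u, v} \<in> set x) \<noteq> ({v, w} \<in> set x)"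
      using crossed_exactly_one[of \<pi> x u w y v] assms(1,2) \<open>distinct E\<close> uvw unfolding E by blast
    then show ?thesis
      using order[of "{u, v}"] order[of "{v, w}"] assms(4)[of u v] assms(4)[of v w] uvw ne
      by (auto simp: is_median_def doubleton_eq_iff split: if_splits)
  qed
  then show ?thesis
    using inj_on_pos[OF assms(2)] by (auto simp: compatible_def inj_on_def)
qed

lemma mobility_clique_if_schedule:
  assumes G: "temporal_clique G" "is_representation R G"
    and \<pi>: "mobility_schedule \<pi> (edge_sequence R)" "set \<pi> = nodes G"
  shows "mobility_clique G"
proof -
  obtain lab where lab: "\<forall>e\<in>edges G. labels G e = {lab e}"
    and E: "set (edge_sequence R) = edges G"
    and sorted: "sorted_wrt (\<lambda>d e. lab d < lab e) (edge_sequence R)"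
    using representation_labels[OF G] by metis
  let ?E = "edge_sequence R"
  let ?T = "map lab ?E"
  have T: "distinct ?T"
    using distinct_if_sorted_wrt_less[OF sorted] .
  then have "distinct ?E"
    by (simp add: distinct_map)
  have pos_T: "pos ?T (lab (?E ! i)) = i" if "i < length ?E" for i
    using pos_nth[OF T, of i] that by simp
  have less: "lab (?E ! i) < lab (?E ! j) \<longleftrightarrow> i < j" if "i < length ?E" "j < length ?E" for i j
    using sorted_wrt_nth_less[OF sorted, of i j] sorted_wrt_nth_less[OF sorted, of j i] that
    by (cases i j rule: linorder_cases) auto
  let ?H = "mobility_graph \<pi> ?E"
  \<comment> \<open>The nodes themselves serve as agents, under the identity; a label is replaced by
    its rank among all labels, plus one because times start at 1.\<close>
  let ?\<phi> = "\<lambda>t. Suc (pos ?T t)"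
  have "strict_mono_on (\<Union>e\<in>edges G. labels G e) ?\<phi>"
  proof (rule strict_mono_onI)
    fix s t
    assume "s \<in> (\<Union>e\<in>edges G. labels G e)" "t \<in> (\<Union>e\<in>edges G. labels G e)" "s < t"
    then have "s \<in> lab ` set ?E" "t \<in> lab ` set ?E"
      using lab E by auto
    then obtain i j where "i < length ?E" "s = lab (?E ! i)" "j < length ?E" "t = lab (?E ! j)"
      by (auto simp: in_set_conv_nth)
    then show "?\<phi> s < ?\<phi> t"
      using \<open>s < t\<close> pos_T less by simp
  qed
  moreover have "labels ?H e = ?\<phi> ` labels G e" if "e \<in> edges G" for e
  proof -
    obtain i where i: "i < length ?E" "e = ?E ! i"
      using \<open>e \<in> edges G\<close> unfolding E[symmetric] in_set_conv_nth by blast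
    have "t = Suc i" if "1 \<le> t" "t \<le> length ?E" "?E ! (t - 1) = e" for t
    proof -
      have "t - 1 = i"
        using that i \<open>distinct ?E\<close> nth_eq_iff_index_eq[of ?E "t - 1" i] by simp
      with that(1) show ?thesis
        by simp
    qed
    then have "labels ?H e = {Suc i}"
      using i by (auto simp: mobility_graph_def)
    then show ?thesis
      using lab that pos_T[OF i(1)] i(2) by simp
  qed
  ultimately have "isomorphic G ?H"
    unfolding isomorphic_def
    by (intro exI[of _ id] exI[of _ ?\<phi>]) (simp add: mobility_graph_def E \<pi>(2))
  then show ?thesis
    using G(1) \<pi>(1) unfolding mobility_clique_def by blast
qed

text \<open>A mobility clique only comes with a schedule of some renamed agents. As
  \<open>\<phi>\<close> is strictly increasing, the crossings happen in the order of the labels, so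
  renaming the edge sequence by \<open>f\<close> gives exactly that schedule; the inverse of
  \<open>f\<close> carries it back to the nodes.\<close>

lemma schedule_if_mobility_clique:
  assumes G: "mobility_clique G" "is_representation R G"
  obtains \<pi> where "mobility_schedule \<pi> (edge_sequence R)" "set \<pi> = nodes G"
proof -
  have clique: "temporal_clique G"
    using G(1) by (simp add: mobility_clique_def)
  obtain \<rho> :: "'a list" and x f \<phi> where \<rho>: "distinct \<rho>" "schedule_steps \<rho> x"
    and f: "bij_betw f (nodes G) (set \<rho>)" and x: "set x = (\<lambda>e. f ` e) ` edges G"
    and \<phi>: "strict_mono_on (\<Union>e\<in>edges G. labels G e) \<phi>"
    and labels: "\<forall>e\<in>edges G. {t. 1 \<le> t \<and> t \<le> length x \<and> x ! (t - 1) = f ` e} = \<phi> ` labels G e"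
    using G(1) unfolding mobility_clique_def isomorphic_def mobility_schedule_def
    by (auto simp: mobility_graph_def)
  obtain lab where lab: "\<forall>e\<in>edges G. labels G e = {lab e}"
    and E: "set (edge_sequence R) = edges G"
    and sorted: "sorted_wrt (\<lambda>d e. lab d < lab e) (edge_sequence R)"
    using representation_labels[OF clique G(2)] by metis
  have times: "{t. 1 \<le> t \<and> t \<le> length x \<and> x ! (t - 1) = f ` e} = {\<phi> (lab e)}" if "e \<in> edges G" for e
    using labels lab that by simp
  \<comment> \<open>A repeated edge would carry two times in the mobility graph, but the isomorphism
    leaves it only the time \<open>\<phi> (lab e)\<close>.\<close>
  have "distinct x"
    unfolding distinct_conv_nth
  proof (intro allI impI notI)
    fix i j
    assume ij: "i < length x" "j < length x" "i \<noteq> j" "x ! i = x ! j"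
    then have "x ! i \<in> (\<lambda>e. f ` e) ` edges G"
      using nth_mem x by blast
    then obtain e where e: "e \<in> edges G" "x ! i = f ` e"
      by blast
    have "Suc i \<in> {\<phi> (lab e)}" "Suc j \<in> {\<phi> (lab e)}"
      unfolding times[OF e(1), symmetric] using ij e(2) by auto
    with ij(3) show False
      by simp
  qed
  have pos_x: "Suc (pos x (f ` e)) = \<phi> (lab e)" if "e \<in> edges G" for e
  proof -
    have "\<phi> (lab e) \<in> {t. 1 \<le> t \<and> t \<le> length x \<and> x ! (t - 1) = f ` e}"
      unfolding times[OF that] by simp
    then show ?thesis
      using pos_nth[OF \<open>distinct x\<close>, of "\<phi> (lab e) - 1"] by auto
  qed
  have "map (image f) (edge_sequence R) = x"
  proof (rule eq_if_sorted_wrt_pos[OF \<open>distinct x\<close>])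
    show "set (map (image f) (edge_sequence R)) = set x"
      by (simp add: E x)
    have "pos x (f ` d) < pos x (f ` e)" if "d \<in> edges G" "e \<in> edges G" "lab d < lab e" for d e
    proof -
      have "\<phi> (lab d) < \<phi> (lab e)"
        using \<phi> that lab by (auto intro!: strict_mono_onD[OF \<phi>])
      then show ?thesis
        using pos_x that by (metis Suc_less_eq)
    qed
    then show "sorted_wrt (\<lambda>u v. pos x u < pos x v) (map (image f) (edge_sequence R))"
      unfolding sorted_wrt_map E[symmetric] by (intro sorted_wrt_mono_rel[OF _ sorted]) blast
  qed
  moreover
  define g where "g = inv_into (nodes G) f"
  have inj: "inj_on f (nodes G)" and img: "f ` nodes G = set \<rho>"
    using f by (auto simp: bij_betw_def)
  have "g ` f ` e = e" if "e \<in> edges G" for e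
  proof -
    have "e \<subseteq> nodes G"
      using that clique by (auto simp: temporal_clique_def)
    then show ?thesis
      using inj unfolding g_def by (rule inv_into_image_cancel[rotated])
  qed
  ultimately have "map (image g) x = edge_sequence R"
    using E by (auto intro!: map_idI)
  then have "schedule_steps (map g \<rho>) (edge_sequence R)"
    using schedule_steps_map[OF \<rho>(2), of g] by simp
  moreover have "distinct (map g \<rho>)" "set (map g \<rho>) = nodes G"
    using \<rho>(1) inj img by (auto simp: distinct_map g_def inj_on_inv_into simp flip: img)
  ultimately show thesis
    using that by (simp add: mobility_schedule_def)
qed

section \<open>Correctness and running time of the recognition\<close>

lemma temporal_clique_length:
  assumes "temporal_clique G" "is_representation R G"
  shows "2 * length R = card (nodes G) * (card (nodes G) - 1)"
proof -
  obtain lab where E: "set (edge_sequence R) = edges G"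
    and sorted: "sorted_wrt (\<lambda>d e. lab d < (lab e :: nat)) (edge_sequence R)"
    using representation_labels[OF assms] by metis
  have "distinct (edge_sequence R)"
    using distinct_if_sorted_wrt_less[OF sorted] by (simp add: distinct_map)
  then have "length R = card (edges G)"
    using E distinct_card by fastforce
  also have "edges G = {e. e \<subseteq> nodes G \<and> card e = 2}"
    using assms(1) by (auto simp: temporal_clique_def card_2_iff)
  also have "card \<dots> = card (nodes G) choose 2"
    using assms(1) by (simp add: temporal_clique_def n_subsets)
  finally show ?thesis
    by (cases "card (nodes G)") (simp_all add: choose_two)
qed

text \<open>With \<open>n\<close> nodes, loading, sorting, positions, scan and final return add up
  to at most \<open>11 * length R + 30 * n^2 + 3 * n + 8\<close>; the factors 100 are generous. Each
  run is judged by the ordering that it happens to compute.\<close>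

lemma recognize_guarantees:
  fixes G :: "'v temporal_graph"
  assumes G: "temporal_clique G" "is_representation R G" and n: "2 \<le> card (nodes G)"
  shows "guarantees (recognize R) (\<lambda>(answer, ordering) c.
    c \<le> 100 * length R + 100 * (card (nodes G))\<^sup>2 \<and> (answer \<longleftrightarrow> mobility_clique G) \<and>
    (answer \<longrightarrow> (\<exists>\<pi>. ordering = Some \<pi> \<and> set \<pi> = nodes G \<and>
                    mobility_schedule \<pi> (edge_sequence R))))" (is "guarantees _ ?Q")
proof -
  let ?V = "nodes G"
  obtain lab where t: "\<forall>(u, v, t)\<in>set R. t = lab {u, v}"
    and E: "set (edge_sequence R) = edges G"
    and sorted: "sorted_wrt (\<lambda>d e. lab d < lab e) (edge_sequence R)"
    using representation_labels[OF G] by metis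
  have V: "finite ?V" and edges: "edges G = {{u, v} | u v. u \<in> ?V \<and> v \<in> ?V \<and> u \<noteq> v}"
    using G(1) by (auto simp: temporal_clique_def)
  \<comment> \<open>Nodes are loaded only through the edges they lie on; a second node guarantees
    that there is one.\<close>
  have "u \<in> \<Union>(edges G)" if "u \<in> ?V" for u
  proof -
    obtain v where "v \<in> ?V" "v \<noteq> u"
      using that n V by (metis card_le_Suc0_iff_eq not_less_eq_eq numeral_2_eq_2)
    then have "{u, v} \<in> edges G"
      using \<open>u \<in> ?V\<close> unfolding edges by blast
    then show ?thesis
      by blast
  qed
  then have nodes: "\<Union>(edges G) = ?V"
    unfolding edges by auto
  have in_V: "\<forall>(u, v, t)\<in>set R. u \<in> ?V \<and> v \<in> ?V"
  proof -
    have "{u, v} \<subseteq> \<Union>(set (edge_sequence R))" if "(u, v, t) \<in> set R" for u v t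
      using that by (force simp: edge_sequence_def)
    then show ?thesis
      unfolding E nodes by auto
  qed
  have compatible: "compatible lab ?V (\<lambda>v. int (pos \<rho> v))"
    if "mobility_schedule \<rho> (edge_sequence R)" "set \<rho> = ?V" for \<rho>
    using compatible_pos[of \<rho> "edge_sequence R" lab] that sorted
    by (auto simp: mobility_schedule_def E edges)
  have accept: "schedule_steps \<pi> (edge_sequence R)"
    if "set \<pi> = ?V" "mobility_schedule \<rho> (edge_sequence R)" "set \<rho> = ?V"
      "sorted_wrt (\<lambda>u v. int (pos \<rho> u) < int (pos \<rho> v)) \<pi> \<or>
       sorted_wrt (\<lambda>u v. int (pos \<rho> v) < int (pos \<rho> u)) \<pi>" for \<pi> \<rho>
  proof -
    have "\<pi> = \<rho> \<or> rev \<pi> = \<rho>"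
      using that eq_if_sorted_wrt_pos[of \<rho> \<pi>] eq_if_sorted_wrt_pos[of \<rho> "rev \<pi>"]
      by (auto simp: mobility_schedule_def sorted_wrt_rev)
    then show ?thesis
      using that(2) schedule_steps_rev[of \<rho>] by (auto simp: mobility_schedule_def)
  qed
  have mono: "1 \<le> (card ?V)\<^sup>2" "card ?V \<le> (card ?V)\<^sup>2"
    using n by (auto simp: power2_eq_square)
  have final: "guarantees (case r of None \<Rightarrow> ret (False, None)
      | Some \<pi> \<Rightarrow> do {
          P \<leftarrow> positions \<pi>;
          answer \<leftarrow> scan R P;
          ret (answer, Some \<pi>)
        }) (\<lambda>s e. ?Q s (c + (d + e)))"
    if c: "c \<le> 3 + 6 * length R" and d: "d \<le> 30 * (card ?V)\<^sup>2 \<and>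
      (\<forall>\<pi>. r = Some \<pi> \<longrightarrow> distinct \<pi> \<and> set \<pi> = ?V) \<and>
      (\<forall>k. compatible lab ?V k \<longrightarrow> (\<exists>\<pi>. r = Some \<pi> \<and>
         (sorted_wrt (\<lambda>u v. k u < k v) \<pi> \<or> sorted_wrt (\<lambda>u v. k v < k u) \<pi>)))" for r c d
  proof (cases r)
    case None
    have "\<not> mobility_clique G"
    proof
      assume "mobility_clique G"
      then obtain \<rho> where "mobility_schedule \<rho> (edge_sequence R)" "set \<rho> = ?V"
        using schedule_if_mobility_clique G(2) by blast
      then show False
        using compatible d None by blast
    qed
    then show ?thesis
      using c d mono None by simp
  next
    case (Some \<pi>)
    then have \<pi>: "distinct \<pi>" "set \<pi> = ?V"
      using d by auto
    have iff: "schedule_steps \<pi> (edge_sequence R) \<longleftrightarrow> mobility_clique G"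
    proof
      assume "schedule_steps \<pi> (edge_sequence R)"
      then show "mobility_clique G"
        using \<pi> mobility_clique_if_schedule[OF G] by (simp add: mobility_schedule_def)
    next
      assume "mobility_clique G"
      then obtain \<rho> where \<rho>: "mobility_schedule \<rho> (edge_sequence R)" "set \<rho> = ?V"
        using schedule_if_mobility_clique G(2) by blast
      then show "schedule_steps \<pi> (edge_sequence R)"
        using accept[OF \<pi>(2) \<rho>] compatible[OF \<rho>] d Some by blast
    qed
    have "guarantees (do { answer \<leftarrow> scan R P; ret (answer, Some \<pi>) })
        (\<lambda>s e. ?Q s (c + (d + (b + e))))"
      if P: "b \<le> 3 + 3 * length \<pi> \<and> (\<forall>v\<in>set \<pi>. P v = Some (pos \<pi> v))" for P b
    proof (rule guarantees_bind[OF scan_guarantees[OF \<pi>(1)]])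
      show "\<forall>(u, v, t)\<in>set R. u \<in> set \<pi> \<and> v \<in> set \<pi>"
        using in_V \<pi>(2) by simp
      show "\<forall>v\<in>set \<pi>. P v = Some (pos \<pi> v)"
        using P by blast
      fix answer a
      assume "a \<le> 1 + 5 * length R \<and> (answer \<longleftrightarrow> schedule_steps \<pi> (edge_sequence R))"
      moreover have "length \<pi> = card ?V"
        using \<pi> distinct_card by metis
      ultimately show "guarantees (ret (answer, Some \<pi>)) (\<lambda>s e. ?Q s (c + (d + (b + (a + e)))))"
        using P c d mono \<pi> iff by (auto simp: mobility_schedule_def)
    qed
    then show ?thesis
      unfolding Some option.case by (rule guarantees_bind[OF positions_guarantees[OF \<pi>(1)]])
  qed
  show ?thesis
    unfolding recognize_def
  proof (rule guarantees_bind[OF load_guarantees[OF t]])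
    fix VL c
    assume VL: "(\<lambda>(V, L) c. c \<le> 3 + 6 * length R \<and> V = \<Union>(set (edge_sequence R)) \<and>
      (\<forall>u v. {u, v} \<in> set (edge_sequence R) \<longrightarrow> L (u, v) = Some (lab {u, v}))) VL c"
    obtain L where L: "VL = (?V, L)" "c \<le> 3 + 6 * length R"
        "\<forall>u v. {u, v} \<in> edges G \<longrightarrow> L (u, v) = Some (lab {u, v})"
      using VL by (cases VL) (simp add: E nodes)
    then have "table_of_labels lab ?V L"
      by (auto simp: table_of_labels_def edges)
    from vertex_sorting_guarantees[OF this V n]
    show "guarantees (case VL of (V, L) \<Rightarrow> do {
        sorting \<leftarrow> vertex_sorting L V;
        (case sorting of
          None \<Rightarrow> ret (False, None)
        | Some \<pi> \<Rightarrow> do {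
            P \<leftarrow> positions \<pi>;
            answer \<leftarrow> scan R P;
            ret (answer, Some \<pi>)
          })
      }) (\<lambda>s d. ?Q s (c + d))"
      unfolding L(1) prod.case by (rule guarantees_bind) (rule final[OF L(2)])
  qed
qed

theorem mainTheorem5:
  shows "\<exists>C::nat. \<forall>(G :: 'v temporal_graph) R.
    temporal_clique G \<longrightarrow> card (nodes G) \<ge> 2 \<longrightarrow> is_representation R G \<longrightarrow>
      outcomes (recognize R) \<noteq> {} \<and>
      (\<forall>r \<in> outcomes (recognize R).
        \<exists>answer ordering time. r = Done (answer, ordering) time \<and>
          time \<le> C * length R \<and> time \<le> C * (card (nodes G))\<^sup>2 \<and>
          (answer \<longleftrightarrow> mobility_clique G) \<and>
          (answer \<longrightarrow> (\<exists>\<pi>. ordering = Some \<pi> \<and> set \<pi> = nodes G \<and>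
                          mobility_schedule \<pi> (edge_sequence R))))"
proof (intro exI[of _ 500] allI impI)
  fix G :: "'v temporal_graph" and R
  assume G: "temporal_clique G" "card (nodes G) \<ge> 2" "is_representation R G"
  let ?n = "card (nodes G)"
  have len: "2 * length R = ?n * (?n - 1)"
    using temporal_clique_length[OF G(1,3)] .
  obtain m where m: "?n = Suc (Suc m)"
    using G(2) by (metis Suc_le_D numeral_2_eq_2 Suc_le_mono)
  \<comment> \<open>From \<open>n <= 2 * (n - 1)\<close> follows \<open>n^2 <= 4 * length R\<close>,
    so \<open>100 * length R + 100 * n^2\<close> is at most \<open>500 * length R\<close>. This is
    where 500 comes from; in terms of \<open>n^2\<close> the factor 200 is already enough.\<close>
  have "length R \<le> ?n\<^sup>2" "?n\<^sup>2 \<le> 4 * length R"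
    using len unfolding m by (simp_all add: power2_eq_square algebra_simps)
  then have time: "time \<le> 500 * length R \<and> time \<le> 500 * ?n\<^sup>2"
    if "time \<le> 100 * length R + 100 * ?n\<^sup>2" for time
    using that by linarith
  have "\<exists>answer ordering time. r = Done (answer, ordering) time \<and>
      time \<le> 500 * length R \<and> time \<le> 500 * ?n\<^sup>2 \<and>
      (answer \<longleftrightarrow> mobility_clique G) \<and>
      (answer \<longrightarrow> (\<exists>\<pi>. ordering = Some \<pi> \<and> set \<pi> = nodes G \<and>
                      mobility_schedule \<pi> (edge_sequence R)))"
    if "r \<in> outcomes (recognize R)" for r
  proof -
    obtain x c where r: "r = Done x c" and x: "(\<lambda>(answer, ordering) c.
        c \<le> 100 * length R + 100 * ?n\<^sup>2 \<and> (answer \<longleftrightarrow> mobility_clique G) \<and>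
        (answer \<longrightarrow> (\<exists>\<pi>. ordering = Some \<pi> \<and> set \<pi> = nodes G \<and>
                        mobility_schedule \<pi> (edge_sequence R)))) x c"
      by (rule guaranteesE[OF recognize_guarantees[OF G(1,3,2)] \<open>r \<in> _\<close>])
    obtain answer ordering where eq: "x = (answer, ordering)"
      by (cases x)
    show ?thesis
      using x time[of c] unfolding r eq prod.case by blast
  qed
  moreover have "outcomes (recognize R) \<noteq> {}"
    by (rule guarantees_nonempty[OF recognize_guarantees[OF G(1,3,2)]])
  ultimately show "outcomes (recognize R) \<noteq> {} \<and>
      (\<forall>r \<in> outcomes (recognize R).
        \<exists>answer ordering time. r = Done (answer, ordering) time \<and>
          time \<le> 500 * length R \<and> time \<le> 500 * ?n\<^sup>2 \<and>
          (answer \<longleftrightarrow> mobility_clique G) \<and>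
          (answer \<longrightarrow> (\<exists>\<pi>. ordering = Some \<pi> \<and> set \<pi> = nodes G \<and>
                          mobility_schedule \<pi> (edge_sequence R))))"
    by (intro conjI ballI)
qed

end
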